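(* Let $\mathbb{K}$ be an algebraically closed field and let $n_1,n_2,n_3\in\mathbb{N}$ be arbitrary. For every nonzero tensor $T\in\mathbb{K}^{n_1}\otimes\mathbb{K}^{n_2}\otimes\mathbb{K}^{n_3}$, exactly one of the following is true: (a) $T$ has a flattening of rank one; (b) $\mathsf{W}\geq T$ and $T\geq\mathsf{W}$; (c) $T\geq\mathsf{I}$ and $T$ has a flattening of rank two; (d) all flattenings of $T$ have rank at least three, in which case at least one of the following is true: - $T\unrhd\mathsf{N}^{(i)}$ for some $i\in\{1,2,3\}$; - $T\geq\mathsf{D}$ and $\mathsf{D}\geq T$.
   Context: Let $\mathbb{K}$ be an algebraically closed field and let $e_1,e_2,\dots$ denote standard basis vectors. Flattenings: the three flattenings of $T\in\mathbb{K}^{n_1}\otimes\mathbb{K}^{n_2}\otimes\mathbb{K}^{n_3}$ are the matrices obtained by viewing $T$ as an element of $\mathbb{K}^{n_1}\otimes(\mathbb{K}^{n_2}\otimes\mathbb{K}^{n_3})$, $\mathbb{K}^{n_2}\otimes(\mathbb{K}^{n_1}\otimes\mathbb{K}^{n_3})$ and $(\mathbb{K}^{n_1}\otimes\mathbb{K}^{n_2})\otimes\mathbb{K}^{n_3}$; their ranks are matrix ranks. Restriction: for $T\in\mathbb{K}^{n_1}\otimes\mathbb{K}^{n_2}\otimes\mathbb{K}^{n_3}$ and $S\in\mathbb{K}^{m_1}\otimes\mathbb{K}^{m_2}\otimes\mathbb{K}^{m_3}$, write $T\geq S$ if there are linear maps $A_i:\mathbb{K}^{n_i}\to\mathbb{K}^{m_i}$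 with $(A_1\otimes A_2\otimes A_3)T=S$. Degeneration: $T\unrhd S$ means that there are linear maps $A(\varepsilon),B(\varepsilon),C(\varepsilon)$ (from $\mathbb{K}^{n_i}$ to $\mathbb{K}^{m_i}$, $i=1,2,3$ respectively) whose coefficients are Laurent polynomials in the formal variable $\varepsilon$, such that $(A(\varepsilon)\otimes B(\varepsilon)\otimes C(\varepsilon))T=S+\varepsilon S_1+\varepsilon^2S_2+\cdots+\varepsilon^tS_t$ for some $t$ and some tensors $S_1,\dots,S_t$ over $\mathbb{K}$. Specific tensors: in $\mathbb{K}^2\otimes\mathbb{K}^2\otimes\mathbb{K}^2$, $\mathsf{I}=e_1\otimes e_1\otimes e_1+e_2\otimes e_2\otimes e_2$, $\mathsf{W}=e_1\otimes e_1\otimes e_2+e_1\otimes e_2\otimes e_1+e_2\otimes e_1\otimes e_1$. In $\mathbb{K}^3\otimes\mathbb{K}^3\otimes\mathbb{K}^3$, $\mathsf{N}^{(1)}=e_1\otimes e_1\otimes e_1+e_2\otimes e_1\otimes e_2+e_2\otimes e_2\otimes e_1+e_3\otimes e_1\otimes e_3+e_3\otimes e_3\otimes e_1$, $\mathsf{N}^{(2)}=e_1\otimes e_1\otimes e_1+e_2\otimes e_2\otimes e_1+e_1\otimes e_2\otimes e_2+e_3\otimes e_3\otimes e_1+e_1\otimes e_3\otimes e_3$, $\mathsf{N}^{(3)}=e_1\otimes e_1\otimes e_1+e_1\otimes e_2\otimes e_2+e_2\otimes e_1\otimes e_2+e_1\otimes e_3\otimes e_3+e_3\otimes e_1\otimes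 e_3$, and $\mathsf{D}$ is the fully skew-symmetric tensor $\mathsf{D}=e_1\otimes e_2\otimes e_3-e_1\otimes e_3\otimes e_2-e_2\otimes e_1\otimes e_3+e_2\otimes e_3\otimes e_1+e_3\otimes e_1\otimes e_2-e_3\otimes e_2\otimes e_1$. *)

theory Defs
  imports "HOL-Analysis.Analysis" "HOL-Computational_Algebra.Formal_Laurent_Series"
begin

unbundle no fps_syntax

text \<open>
  A tensor in \<open>K\<^sup>n\<^sup>1 \<otimes> K\<^sup>n\<^sup>2 \<otimes> K\<^sup>n\<^sup>3\<close> is given by its coordinates with respect to the standard bases;
  the coefficient of \<open>e\<^sub>i \<otimes> e\<^sub>j \<otimes> e\<^sub>k\<close> in \<open>T\<close> is \<open>T $ i $ j $ k\<close>. The dimensions are the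
  cardinalities of the index types. These are positive, which loses nothing for nonzero tensors.
\<close>

type_synonym ('a, 'n1, 'n2, 'n3) tensor = "'a ^ 'n3 ^ 'n2 ^ 'n1"

definition tensor_prod ::
  "'a::times ^ 'n1 \<Rightarrow> 'a ^ 'n2 \<Rightarrow> 'a ^ 'n3 \<Rightarrow> ('a, 'n1::finite, 'n2::finite, 'n3::finite) tensor" where
  "tensor_prod u v w = (\<chi> i j k. u $ i * v $ j * w $ k)"

text \<open>Flattenings are matrices whose row or column index is a pair of tensor indices.\<close>

definition flattening1 :: "('a, 'n1::finite, 'n2::finite, 'n3::finite) tensor \<Rightarrow> 'a ^ ('n2 \<times> 'n3) ^ 'n1" where
  "flattening1 T = (\<chi> i jk. T $ i $ fst jk $ snd jk)"

definition flattening2 :: "('a, 'n1::finite, 'n2::finite, 'n3::finite) tensor \<Rightarrow> 'a ^ ('n1 \<times> 'n3) ^ 'n2" where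
  "flattening2 T = (\<chi> j ik. T $ fst ik $ j $ snd ik)"

definition flattening3 :: "('a, 'n1::finite, 'n2::finite, 'n3::finite) tensor \<Rightarrow> 'a ^ 'n3 ^ ('n1 \<times> 'n2)" where
  "flattening3 T = (\<chi> ij k. T $ fst ij $ snd ij $ k)"

text \<open>
  The image \<open>(A \<otimes> B \<otimes> C) T\<close>, where the linear maps are given by their matrices
  (\<open>'a ^ 'n ^ 'm\<close> is the type of matrices of maps from \<open>K\<^sup>n\<close> to \<open>K\<^sup>m\<close>). The entries are
  allowed to come from any commutative semiring, so that Laurent polynomials can be used too.
\<close>

definition apply_tensor ::
  "'a::comm_semiring_1 ^ 'n1 ^ 'm1 \<Rightarrow> 'a ^ 'n2 ^ 'm2 \<Rightarrow> 'a ^ 'n3 ^ 'm3 \<Rightarrow>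
    ('a, 'n1::finite, 'n2::finite, 'n3::finite) tensor \<Rightarrow> ('a, 'm1::finite, 'm2::finite, 'm3::finite) tensor" where
  "apply_tensor A B C T =
    (\<chi> a b c. \<Sum>i\<in>UNIV. \<Sum>j\<in>UNIV. \<Sum>k\<in>UNIV. A $ a $ i * B $ b $ j * C $ c $ k * T $ i $ j $ k)"

definition restricts_to ::
  "('a::field, 'n1::finite, 'n2::finite, 'n3::finite) tensor \<Rightarrow> ('a, 'm1::finite, 'm2::finite, 'm3::finite) tensor \<Rightarrow> bool"
  (infix "\<ge>\<^sub>t" 50) where
  "T \<ge>\<^sub>t S \<longleftrightarrow> (\<exists>A B C. apply_tensor A B C T = S)"

text \<open>
  Laurent polynomials are the formal Laurent series with finitely many nonzero coefficients;
  the formal variable is \<^const>\<open>fls_X\<close>.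
\<close>

definition laurent_polynomial :: "'a::zero fls \<Rightarrow> bool" where
  "laurent_polynomial f \<longleftrightarrow> finite {n. fls_nth f n \<noteq> 0}"

definition laurent_polynomial_matrix :: "'a::zero fls ^ 'n ^ 'm \<Rightarrow> bool" where
  "laurent_polynomial_matrix A \<longleftrightarrow> (\<forall>i j. laurent_polynomial (A $ i $ j))"

definition const_tensor ::
  "('a::zero, 'n1::finite, 'n2::finite, 'n3::finite) tensor \<Rightarrow> ('a fls, 'n1::finite, 'n2::finite, 'n3::finite) tensor" where
  "const_tensor T = (\<chi> i j k. fls_const (T $ i $ j $ k))"

definition scale_tensor ::
  "'a::times \<Rightarrow> ('a, 'n1::finite, 'n2::finite, 'n3::finite) tensor \<Rightarrow> ('a, 'n1::finite, 'n2::finite, 'n3::finite) tensor" where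
  "scale_tensor x T = (\<chi> i j k. x * T $ i $ j $ k)"

definition degenerates_to ::
  "('a::field, 'n1::finite, 'n2::finite, 'n3::finite) tensor \<Rightarrow> ('a, 'm1::finite, 'm2::finite, 'm3::finite) tensor \<Rightarrow> bool"
  (infix "\<unrhd>\<^sub>t" 50) where
  "T \<unrhd>\<^sub>t S \<longleftrightarrow>
    (\<exists>A B C.
      laurent_polynomial_matrix A \<and> laurent_polynomial_matrix B \<and> laurent_polynomial_matrix C \<and>
      (\<exists>t::nat. \<exists>R :: nat \<Rightarrow> ('a, 'm1, 'm2, 'm3) tensor.
        apply_tensor A B C (const_tensor T) =
          const_tensor S + (\<Sum>r=1..t. scale_tensor (fls_X ^ r) (const_tensor (R r)))))"

text \<open>
  In the numeral types \<open>2\<close> and \<open>3\<close> the indices \<open>1, 2\<close> and \<open>1, 2, 3\<close> are pairwise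
  distinct and exhaust the type.
\<close>

definition basis_tensor :: "'n1 \<Rightarrow> 'n2 \<Rightarrow> 'n3 \<Rightarrow> ('a::field, 'n1::finite, 'n2::finite, 'n3::finite) tensor" where
  "basis_tensor i j k = tensor_prod (axis i 1) (axis j 1) (axis k 1)"

definition I_tensor :: "('a::field, 2, 2, 2) tensor" where
  "I_tensor = basis_tensor 1 1 1 + basis_tensor 2 2 2"

definition W_tensor :: "('a::field, 2, 2, 2) tensor" where
  "W_tensor = basis_tensor 1 1 2 + basis_tensor 1 2 1 + basis_tensor 2 1 1"

definition N1_tensor :: "('a::field, 3, 3, 3) tensor" where
  "N1_tensor = basis_tensor 1 1 1 + basis_tensor 2 1 2 + basis_tensor 2 2 1
    + basis_tensor 3 1 3 + basis_tensor 3 3 1"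

definition N2_tensor :: "('a::field, 3, 3, 3) tensor" where
  "N2_tensor = basis_tensor 1 1 1 + basis_tensor 2 2 1 + basis_tensor 1 2 2
    + basis_tensor 3 3 1 + basis_tensor 1 3 3"

definition N3_tensor :: "('a::field, 3, 3, 3) tensor" where
  "N3_tensor = basis_tensor 1 1 1 + basis_tensor 1 2 2 + basis_tensor 2 1 2
    + basis_tensor 1 3 3 + basis_tensor 3 1 3"

definition D_tensor :: "('a::field, 3, 3, 3) tensor" where
  "D_tensor = basis_tensor 1 2 3 - basis_tensor 1 3 2 - basis_tensor 2 1 3
    + basis_tensor 2 3 1 + basis_tensor 3 1 2 - basis_tensor 3 2 1"

end

theory Submission
  imports Defs
begin

text \<open>
  Viewing \<open>T\<close> as a trilinear form, a restriction of \<open>T\<close> is a choice of vectors in its three arguments.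

  If one flattening has rank two, \<open>T\<close> is a pencil of bilinear forms spanned by some \<open>E\<close> and \<open>M\<close> such that
  \<open>E\<close> restricts to the identity on a \<open>2 \<times> 2\<close> block. Shifting \<open>M\<close> by an eigenvalue, its block is
  singular. If it has nonzero trace, it has two distinct eigenvalues and \<open>T \<ge> I\<close>; if it is nilpotent and
  nonzero, \<open>T \<ge> W\<close>. Every way in which \<open>T\<close> can fail to be supported on the block, or in which the block
  of \<open>M\<close> can vanish, produces a different block with two distinct eigenvalues.

  Suppose now that all flattenings have rank at least three. If the slices in two of the three directions
  reach rank three, a generic choice makes a slice \<open>T(\<cdot>, y\<^sub>1, \<cdot>)\<close> and a slice \<open>T(\<cdot>, \<cdot>, z\<^sub>1)\<close> equal to the
  identity with respect to the same basis \<open>x\<^sub>1, x\<^sub>2, x\<^sub>3\<close>; what remains outside these two slices is removed by the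
  weights \<open>(0, -1, -1)\<close>, \<open>(0, 1, 1)\<close>, \<open>(0, 1, 1)\<close>. Otherwise the slices in two directions have rank at
  most two, and the vanishing of all \<open>3 \<times> 3\<close> minors of these slices forces \<open>T\<close> to be equivalent to \<open>D\<close>.
\<close>

(* The bundle fps_syntax of Formal_Laurent_Series hides the one that declares this notation. *)
no_notation fps_nth (infixl "$" 75)

section \<open>Rank over an arbitrary field\<close>

text \<open>The library proves the equality of row and column rank only for real matrices.\<close>

lemma dim_columns_le_dim_rows:
  fixes A :: "'a::field^'n^'m"
  shows "vec.dim (columns A) \<le> vec.dim (rows A)"
proof -
  obtain B where B: "B \<subseteq> rows A" "vec.independent B" "rows A \<subseteq> vec.span B" "card B = vec.dim (rows A)"
    using vec.basis_exists by blast
  have fin: "finite B" using vec.finiteI_independent[OF B(2)] .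
  have "\<exists>u. row i A = (\<Sum>b\<in>B. u b *s b)" for i
    using B(3) vec.span_finite[OF fin] by (auto simp: rows_def)
  then obtain u where u: "row i A = (\<Sum>b\<in>B. u i b *s b)" for i by metis
  \<comment> \<open>The coefficients \<open>u\<close> factor \<open>A\<close> through a space of
    dimension \<open>card B\<close>; read columnwise, the same factorization puts every column in
    the span of the \<open>c b\<close>.\<close>
  define c where "c b = (\<chi> i. u i b)" for b
  have col: "column j A = (\<Sum>b\<in>B. b $ j *s c b)" for j
  proof -
    have "column j A $ i = row i A $ j" for i by (simp add: column_def row_def)
    then show ?thesis by (simp add: u vec_eq_iff c_def mult.commute)
  qed
  have "column j A \<in> vec.span (c ` B)" for j
    unfolding col by (intro vec.span_sum vec.span_scale) (simp add: vec.span_base)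
  then have "columns A \<subseteq> vec.span (c ` B)"
    unfolding columns_def by auto
  then have "vec.dim (columns A) \<le> card (c ` B)"
    using fin by (intro vec.dim_le_card) auto
  also have "\<dots> \<le> vec.dim (rows A)" using B(4) card_image_le[OF fin] by metis
  finally show ?thesis .
qed

lemma rank_eq_dim_columns:
  fixes A :: "'a::field^'n^'m"
  shows "rank A = vec.dim (columns A)"
  using dim_columns_le_dim_rows[of A] dim_columns_le_dim_rows[of "transpose A"]
  by (simp add: row_rank_def_gen)

lemma rank_transpose_eq:
  fixes A :: "'a::field^'n^'m"
  shows "rank (transpose A) = rank A"
  by (metis rank_eq_dim_columns row_rank_def_gen rows_transpose)

lemma sum_scale_vector_matrix_mult:
  fixes A :: "'a::comm_semiring_1^'c^'n"
  shows "(\<Sum>a\<in>S. c a *s X a) v* A = (\<Sum>a\<in>S. c a *s (X a v* A))"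
  by (simp add: vec_eq_iff vector_matrix_mult_def sum_distrib_left sum_distrib_right mult.assoc
      sum.swap[of _ S])

lemma diff_vector_matrix_mult:
  fixes A :: "'a::comm_ring_1^'c^'n"
  shows "(x - y) v* A = x v* A - y v* A"
  by (simp add: vec_eq_iff vector_matrix_mult_def sum_subtractf algebra_simps)

lemma rank_eq_dim_range:
  fixes A :: "'a::field^'n^'m"
  shows "rank A = vec.dim (range (\<lambda>x. x v* A))"
proof -
  have "range (\<lambda>x. x v* A) = vec.span (rows A)"
  proof
    have "x v* A = (\<Sum>i\<in>UNIV. x $ i *s row i A)" for x
      by (simp add: vec_eq_iff vector_matrix_mult_def row_def)
    moreover have "row i A \<in> vec.span (rows A)" for i
      by (rule vec.span_base) (auto simp: rows_def)
    ultimately show "range (\<lambda>x. x v* A) \<subseteq> vec.span (rows A)"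
      by (auto intro!: vec.span_sum vec.span_scale)
    have "vec.subspace (range (\<lambda>x. x v* A))"
      using vec.subspace_image[of UNIV "transpose A"] by simp
    moreover have "rows A \<subseteq> range (\<lambda>x. x v* A)"
    proof
      fix r assume "r \<in> rows A"
      then obtain i where "r = row i A" by (auto simp: rows_def)
      then have "r = axis i 1 v* A"
        by (simp add: vec_eq_iff vector_matrix_mult_def row_def axis_def if_distrib if_distribR cong: if_cong)
      then show "r \<in> range (\<lambda>x. x v* A)" by blast
    qed
    ultimately show "vec.span (rows A) \<subseteq> range (\<lambda>x. x v* A)"
      using vec.span_minimal by blast
  qed
  then show ?thesis by (simp add: row_rank_def_gen)
qed

text \<open>The map \<open>x v* A\<close> factors through \<open>x v* B\<close>: if \<open>g\<close>
  is a linear right inverse on the range of the latter, \<open>x\<close> and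
  \<open>g (x v* B)\<close> differ by an element of the kernel. This compares flattenings whose
  columns have different index types.\<close>

lemma rank_le_if_kernel_subset:
  fixes A :: "'a::field^'c^'n" and B :: "'a^'d^'n"
  assumes "\<And>x. x v* B = 0 \<Longrightarrow> x v* A = 0"
  shows "rank A \<le> rank B"
proof -
  let ?B = "transpose B"
  obtain g where g: "Vector_Spaces.linear (*s) (*s) g" "\<forall>v\<in>range ((*v) ?B). ?B *v (g v) = v"
    using vec.linear_exists_right_inverse_on[OF matrix_vector_mul_linear_gen[of ?B] vec.subspace_UNIV] by blast
  have lin: "Vector_Spaces.linear (*s) (*s) (\<lambda>y. g y v* A)"
    using Vector_Spaces.linear_compose[OF g(1) matrix_vector_mul_linear_gen[of "transpose A"]]
    by (simp add: o_def)
  have "x v* A = g (x v* B) v* A" for x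
  proof -
    have "(x - g (x v* B)) v* B = 0"
      using g(2) by (simp add: diff_vector_matrix_mult)
    then have "(x - g (x v* B)) v* A = 0"
      by (rule assms)
    then show ?thesis by (simp add: diff_vector_matrix_mult)
  qed
  then have "range (\<lambda>x. x v* A) = (\<lambda>y. g y v* A) ` range (\<lambda>x. x v* B)"
    by auto
  then show ?thesis
    using vec.dim_image_le[OF lin] by (simp add: rank_eq_dim_range)
qed

lemma rank_eq_if_kernel_eq:
  fixes A :: "'a::field^'c^'n" and B :: "'a^'d^'n"
  assumes "\<And>x. x v* A = 0 \<longleftrightarrow> x v* B = 0"
  shows "rank A = rank B"
  by (intro antisym rank_le_if_kernel_subset) (simp_all add: assms)

text \<open>The rows of \<open>F\<close> are \<open>CARD('m)\<close> linear functionals, and a map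
  determined by their values has at most that rank.\<close>

lemma rank_le_card_if_kernel_subset:
  fixes A :: "'a::field^'c^'n" and F :: "'a^'n^'m"
  assumes "\<And>x. F *v x = 0 \<Longrightarrow> x v* A = 0"
  shows "rank A \<le> CARD('m)"
proof -
  have "rank A \<le> rank (transpose F)"
    by (rule rank_le_if_kernel_subset) (simp add: assms)
  also have "\<dots> \<le> CARD('m)"
    unfolding rank_eq_dim_range by (metis vec_dim_card vec.dim_subset subset_UNIV)
  finally show ?thesis .
qed

lemma vector_matrix_mult_eq_0_if_rank_eq_0:
  fixes A :: "'a::field^'c^'n"
  assumes "rank A = 0"
  shows "x v* A = 0"
proof -
  have "range (\<lambda>x. x v* A) \<subseteq> vec.span {}"
    using assms by (intro vec.card_ge_dim_independent) (auto simp: rank_eq_dim_range vec.independent_empty)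
  then show ?thesis by auto
qed

lemma independent_image_family:
  fixes A :: "'a::field^'c^'n" and X :: "'m::finite \<Rightarrow> 'a^'n"
  assumes "\<And>c. (\<Sum>a\<in>UNIV. c a *s X a) v* A = 0 \<Longrightarrow> \<forall>a. c a = 0"
  shows "inj (\<lambda>a. X a v* A)" and "vec.independent (range (\<lambda>a. X a v* A))"
proof -
  let ?f = "\<lambda>a. X a v* A"
  have lin: "(\<Sum>a\<in>UNIV. c a *s X a) v* A = (\<Sum>a\<in>UNIV. c a *s ?f a)" for c
    by (rule sum_scale_vector_matrix_mult)
  show inj: "inj ?f"
  proof
    fix a b assume "?f a = ?f b"
    \<comment> \<open>The coefficients are 1 at \<open>a\<close> and -1 at \<open>b\<close>; they
      all vanish only if \<open>a = b\<close>.\<close>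
    then have *: "(\<Sum>d\<in>UNIV. (of_bool (d = a) - of_bool (d = b)) *s ?f d) = 0"
      by (simp add: vec.scale_left_diff_distrib sum_subtractf of_bool_def if_distrib[of "\<lambda>x. x *s _"] cong: if_cong)
    then show "a = b"
      using assms[of "\<lambda>d. of_bool (d = a) - of_bool (d = b)"] unfolding lin
      by (metis (full_types) diff_zero of_bool_eq_0_iff of_bool_eq(1) right_minus_eq zero_neq_one of_bool_eq(2))
  qed
  show "vec.independent (range ?f)"
  proof (rule vec.independent_if_scalars_zero)
    fix c v assume *: "(\<Sum>x\<in>range ?f. c x *s x) = 0" and v: "v \<in> range ?f"
    have "(\<Sum>a\<in>UNIV. c (?f a) *s ?f a) = 0"
      using * by (simp add: sum.reindex[OF inj])
    then show "c v = 0" using assms[of "\<lambda>a. c (?f a)"] v unfolding lin by auto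
  qed simp
qed

lemma card_le_rank:
  fixes A :: "'a::field^'c^'n" and X :: "'m::finite \<Rightarrow> 'a^'n"
  assumes "\<And>c. (\<Sum>a\<in>UNIV. c a *s X a) v* A = 0 \<Longrightarrow> \<forall>a. c a = 0"
  shows "CARD('m) \<le> rank A"
proof -
  note ind = independent_image_family[OF assms]
  have "card (range (\<lambda>a. X a v* A)) \<le> vec.dim (range (\<lambda>x. x v* A))"
    by (rule vec.independent_card_le_dim[OF _ ind(2)]) auto
  then show ?thesis
    by (simp add: rank_eq_dim_range card_image[OF ind(1)])
qed

text \<open>Independent images, at least as many as the rank, form a basis of the range; so the
  family spans modulo the kernel.\<close>

lemma spanning_if_card_ge_rank:
  fixes A :: "'a::field^'c^'n" and X :: "'m::finite \<Rightarrow> 'a^'n"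
  assumes ind: "\<And>c. (\<Sum>a\<in>UNIV. c a *s X a) v* A = 0 \<Longrightarrow> \<forall>a. c a = 0"
    and le: "rank A \<le> CARD('m)"
  shows "\<exists>c. (x - (\<Sum>a\<in>UNIV. c a *s X a)) v* A = 0"
proof -
  let ?f = "\<lambda>a. X a v* A"
  note ind' = independent_image_family[OF ind]
  have "range (\<lambda>x. x v* A) \<subseteq> vec.span (range ?f)"
    using le by (intro vec.card_ge_dim_independent ind')
      (auto simp: rank_eq_dim_range card_image[OF ind'(1)])
  then have "x v* A \<in> vec.span (range ?f)" by blast
  then obtain u where "x v* A = (\<Sum>v\<in>range ?f. u v *s v)"
    by (auto simp: vec.span_finite)
  then have "x v* A = (\<Sum>a\<in>UNIV. u (?f a) *s ?f a)"
    by (simp add: sum.reindex[OF ind'(1)])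
  then have "(x - (\<Sum>a\<in>UNIV. u (?f a) *s X a)) v* A = 0"
    by (simp add: diff_vector_matrix_mult sum_scale_vector_matrix_mult)
  then show ?thesis by (intro exI[of _ "\<lambda>a. u (?f a)"])
qed

section \<open>The trilinear form of a tensor\<close>

definition tri ::
  "('a::field, 'n1::finite, 'n2::finite, 'n3::finite) tensor \<Rightarrow> 'a^'n1 \<Rightarrow> 'a^'n2 \<Rightarrow> 'a^'n3 \<Rightarrow> 'a" where
  "tri T x y z = (\<Sum>i\<in>UNIV. \<Sum>j\<in>UNIV. \<Sum>k\<in>UNIV. x $ i * y $ j * z $ k * T $ i $ j $ k)"

lemma tri_add:
  "tri T (x + x') y z = tri T x y z + tri T x' y z"
  "tri T x (y + y') z = tri T x y z + tri T x y' z"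
  "tri T x y (z + z') = tri T x y z + tri T x y z'"
  by (simp_all add: tri_def algebra_simps sum.distrib)

lemma tri_scale:
  "tri T (c *s x) y z = c * tri T x y z"
  "tri T x (c *s y) z = c * tri T x y z"
  "tri T x y (c *s z) = c * tri T x y z"
  by (simp_all add: tri_def sum_distrib_left mult_ac)

lemma tri_diff:
  "tri T (x - x') y z = tri T x y z - tri T x' y z"
  "tri T x (y - y') z = tri T x y z - tri T x y' z"
  "tri T x y (z - z') = tri T x y z - tri T x y z'"
  by (simp_all add: tri_def algebra_simps sum_subtractf)

lemma tri_minus:
  "tri T (- x) y z = - tri T x y z"
  "tri T x (- y) z = - tri T x y z"
  "tri T x y (- z) = - tri T x y z"
  by (simp_all add: tri_def sum_negf)

lemma tri_zero [simp]: "tri T 0 y z = 0" "tri T x 0 z = 0" "tri T x y 0 = 0"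
  by (simp_all add: tri_def)

lemma tri_sum:
  "tri T (\<Sum>a\<in>S. f a) y z = (\<Sum>a\<in>S. tri T (f a) y z)"
  "tri T x (\<Sum>a\<in>S. g a) z = (\<Sum>a\<in>S. tri T x (g a) z)"
  "tri T x y (\<Sum>a\<in>S. h a) = (\<Sum>a\<in>S. tri T x y (h a))"
  by (induction S rule: infinite_finite_induct) (simp_all add: tri_add)

lemmas tri_linear = tri_add tri_scale tri_diff tri_minus tri_sum

lemma sum_axis: "(\<Sum>i\<in>UNIV. axis (a::'n::finite) (1::'a::field) $ i * f i) = f a"
  by (simp add: axis_def if_distribR if_distrib cong: if_cong)

lemma tri_axis: "tri T (axis i 1) (axis j 1) (axis k 1) = T $ i $ j $ k"
proof -
  have "tri T x y z = (\<Sum>i\<in>UNIV. x $ i * (\<Sum>j\<in>UNIV. y $ j * (\<Sum>k\<in>UNIV. z $ k * T $ i $ j $ k)))" for x y z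
    by (simp add: tri_def sum_distrib_left mult.assoc)
  then show ?thesis by (simp only: sum_axis)
qed

lemma tri_tensor_add: "tri (S + T) x y z = tri S x y z + tri T x y z"
  by (simp add: tri_def algebra_simps sum.distrib)

lemma tri_basis_tensor: "tri (basis_tensor a b c) x y z = x $ a * y $ b * z $ c"
proof -
  have "tri (basis_tensor a b c) x y z = (\<Sum>i\<in>UNIV. axis a 1 $ i * (x $ i *
      (\<Sum>j\<in>UNIV. axis b 1 $ j * (y $ j * (\<Sum>k\<in>UNIV. axis c 1 $ k * z $ k)))))"
    by (simp add: tri_def basis_tensor_def tensor_prod_def sum_distrib_left mult_ac)
  then show ?thesis by (simp only: sum_axis) (simp add: mult.assoc)
qed

lemma basis_tensor_nth:
  "basis_tensor a b c $ i $ j $ k = of_bool (i = a \<and> j = b \<and> k = c)"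
  by (simp add: basis_tensor_def tensor_prod_def axis_def of_bool_def)

lemma apply_tensor_nth:
  "apply_tensor A B C T $ a $ b $ c = tri T (A $ a) (B $ b) (C $ c)"
  by (simp add: apply_tensor_def tri_def)

lemma restricts_to_iff:
  "T \<ge>\<^sub>t S \<longleftrightarrow> (\<exists>X Y Z. \<forall>a b c. tri T (X a) (Y b) (Z c) = S $ a $ b $ c)"
proof
  assume "T \<ge>\<^sub>t S"
  then obtain A B C where "apply_tensor A B C T = S" by (auto simp: restricts_to_def)
  then show "\<exists>X Y Z. \<forall>a b c. tri T (X a) (Y b) (Z c) = S $ a $ b $ c"
    by (intro exI[of _ "($) A"] exI[of _ "($) B"] exI[of _ "($) C"]) (auto simp: apply_tensor_nth)
next
  assume "\<exists>X Y Z. \<forall>a b c. tri T (X a) (Y b) (Z c) = S $ a $ b $ c"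
  then obtain X Y Z where *: "\<And>a b c. tri T (X a) (Y b) (Z c) = S $ a $ b $ c" by blast
  have "apply_tensor (\<chi> a. X a) (\<chi> b. Y b) (\<chi> c. Z c) T = S"
    by (simp add: vec_eq_iff apply_tensor_nth *)
  then show "T \<ge>\<^sub>t S" unfolding restricts_to_def by blast
qed

lemma restricts_toI:
  "(\<And>a b c. tri T (X a) (Y b) (Z c) = S $ a $ b $ c) \<Longrightarrow> T \<ge>\<^sub>t S"
  unfolding restricts_to_iff by blast

lemma vec_expand: "x = (\<Sum>i\<in>UNIV. x $ i *s axis i 1)"
  for x :: "'a::field^'n"
  by (simp add: vec_eq_iff axis_def if_distrib cong: if_cong)

lemma tri_apply_tensor:
  "tri (apply_tensor A B C T) x y z = tri T (x v* A) (y v* B) (z v* C)"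
proof -
  have v: "v v* M = (\<Sum>a\<in>UNIV. v $ a *s M $ a)" for v :: "'a::field^'n" and M :: "'a^'m^'n"
    by (simp add: vec_eq_iff vector_matrix_mult_def)
  have 1: "tri T (x v* A) y' z' = (\<Sum>i\<in>UNIV. x $ i * tri T (A $ i) y' z')" for y' z'
    by (simp only: v tri_sum tri_scale)
  have 2: "tri T x' (y v* B) z' = (\<Sum>j\<in>UNIV. y $ j * tri T x' (B $ j) z')" for x' z'
    by (simp only: v tri_sum tri_scale)
  have 3: "tri T x' y' (z v* C) = (\<Sum>k\<in>UNIV. z $ k * tri T x' y' (C $ k))" for x' y'
    by (simp only: v tri_sum tri_scale)
  show ?thesis
    unfolding 1 unfolding 2 unfolding 3
    by (simp add: tri_def[of "apply_tensor A B C T"] apply_tensor_nth mult.assoc sum_distrib_left)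
qed

section \<open>Permutations of the tensor factors\<close>

definition swap12 :: "('a, 'n1::finite, 'n2::finite, 'n3::finite) tensor \<Rightarrow> ('a, 'n2, 'n1, 'n3) tensor" where
  "swap12 T = (\<chi> j i k. T $ i $ j $ k)"

definition swap23 :: "('a, 'n1::finite, 'n2::finite, 'n3::finite) tensor \<Rightarrow> ('a, 'n1, 'n3, 'n2) tensor" where
  "swap23 T = (\<chi> i k j. T $ i $ j $ k)"

lemma swap_nth [simp]:
  "swap12 T $ j $ i $ k = T $ i $ j $ k"
  "swap23 T $ i $ k $ j = T $ i $ j $ k"
  by (simp_all add: swap12_def swap23_def)

lemma swap_swap [simp]: "swap12 (swap12 T) = T" "swap23 (swap23 T) = T"
  by (simp_all add: vec_eq_iff)

lemma tri_swap [simp]: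
  "tri (swap12 T) y x z = tri T x y z"
  "tri (swap23 T) x z y = tri T x y z"
proof -
  show "tri (swap12 T) y x z = tri T x y z"
    unfolding tri_def by (subst sum.swap) (simp add: mult_ac)
  show "tri (swap23 T) x z y = tri T x y z"
    unfolding tri_def by (intro sum.cong refl, subst sum.swap) (simp add: mult_ac)
qed

lemma restricts_to_swapI:
  assumes "T \<ge>\<^sub>t S"
  shows "swap12 T \<ge>\<^sub>t swap12 S" "swap23 T \<ge>\<^sub>t swap23 S"
proof -
  obtain X Y Z where *: "\<And>a b c. tri T (X a) (Y b) (Z c) = S $ a $ b $ c"
    using assms unfolding restricts_to_iff by blast
  show "swap12 T \<ge>\<^sub>t swap12 S" by (rule restricts_toI[of _ Y X Z]) (simp add: *)
  show "swap23 T \<ge>\<^sub>t swap23 S" by (rule restricts_toI[of _ X Z Y]) (simp add: *)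
qed

lemma restricts_to_swap:
  "swap12 T \<ge>\<^sub>t swap12 S \<longleftrightarrow> T \<ge>\<^sub>t S"
  "swap23 T \<ge>\<^sub>t swap23 S \<longleftrightarrow> T \<ge>\<^sub>t S"
  by (metis restricts_to_swapI(1) swap_swap(1), metis restricts_to_swapI(2) swap_swap(2))

section \<open>Flattening ranks through the trilinear form\<close>

lemma vm_flattening1: "x v* flattening1 T = 0 \<longleftrightarrow> (\<forall>y z. tri T x y z = 0)"
proof -
  have *: "(x v* flattening1 T) $ (j, k) = tri T x (axis j 1) (axis k 1)" for j k
  proof -
    have "tri T x (axis j 1) (axis k 1) = tri T (\<Sum>i\<in>UNIV. x $ i *s axis i 1) (axis j 1) (axis k 1)"
      using vec_expand[of x] by simp
    also have "\<dots> = (x v* flattening1 T) $ (j, k)"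
      by (simp add: tri_linear tri_axis vector_matrix_mult_def flattening1_def)
    finally show ?thesis ..
  qed
  show ?thesis
  proof
    assume "x v* flattening1 T = 0"
    then have 0: "tri T x (axis j 1) (axis k 1) = 0" for j k by (simp add: *[symmetric])
    have "tri T x (\<Sum>j\<in>UNIV. y $ j *s axis j 1) (\<Sum>k\<in>UNIV. z $ k *s axis k 1) = 0" for y z
      by (simp add: tri_linear 0)
    then show "\<forall>y z. tri T x y z = 0" by (simp add: vec_expand[symmetric])
  qed (simp add: vec_eq_iff *)
qed

lemma vm_flattening2: "y v* flattening2 T = 0 \<longleftrightarrow> (\<forall>x z. tri T x y z = 0)"
proof -
  have "flattening2 T = flattening1 (swap12 T)"
    by (simp add: flattening1_def flattening2_def swap12_def)
  then show ?thesis by (simp add: vm_flattening1)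
qed

lemma vm_flattening3: "flattening3 T *v z = 0 \<longleftrightarrow> (\<forall>x y. tri T x y z = 0)"
proof -
  have "transpose (flattening3 T) = flattening1 (swap12 (swap23 T))"
    by (simp add: flattening1_def flattening3_def swap12_def swap23_def transpose_def vec_eq_iff)
  then have "flattening3 T *v z = z v* flattening1 (swap12 (swap23 T))"
    by (metis transpose_matrix_vector transpose_transpose)
  then show ?thesis by (simp add: vm_flattening1)
qed

text \<open>Permuting factors changes a flattening only by reindexing or transposition, so the
  kernels in the distinguished argument agree. Results on \<open>flattening1\<close> transfer to the
  third factor through \<open>swap12 (swap23 T)\<close>, which brings that factor to the
  front.\<close>

lemma rank_flattening_swap12:
  "rank (flattening1 (swap12 T)) = rank (flattening2 T)"
  "rank (flattening2 (swap12 T)) = rank (flattening1 T)"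
  "rank (flattening3 (swap12 T)) = rank (flattening3 T)"
  unfolding rank_transpose_eq[of "flattening3 _", symmetric]
  by (intro rank_eq_if_kernel_eq; auto simp: vm_flattening1 vm_flattening2 vm_flattening3)+

lemma rank_flattening_swap23:
  "rank (flattening1 (swap23 T)) = rank (flattening1 T)"
  "rank (flattening2 (swap23 T)) = rank (flattening3 T)"
  "rank (flattening3 (swap23 T)) = rank (flattening2 T)"
  unfolding rank_transpose_eq[of "flattening3 _", symmetric]
  by (intro rank_eq_if_kernel_eq; auto simp: vm_flattening1 vm_flattening2 vm_flattening3)+

lemma card_le_rank_flattening1:
  fixes X :: "'m::finite \<Rightarrow> 'a::field^'n1"
  assumes "\<And>c. (\<And>y z. (\<Sum>a\<in>UNIV. c a * tri T (X a) y z) = 0) \<Longrightarrow> \<forall>a. c a = 0"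
  shows "CARD('m) \<le> rank (flattening1 T)"
  using assms by (intro card_le_rank[of X]) (simp add: vm_flattening1 tri_linear)

lemma spanning_flattening1:
  fixes X :: "'m::finite \<Rightarrow> 'a::field^'n1"
  assumes "\<And>c. (\<And>y z. (\<Sum>a\<in>UNIV. c a * tri T (X a) y z) = 0) \<Longrightarrow> \<forall>a. c a = 0"
    and "rank (flattening1 T) \<le> CARD('m)"
  shows "\<exists>c. \<forall>y z. tri T x y z = (\<Sum>a\<in>UNIV. c a * tri T (X a) y z)"
proof -
  have "\<exists>c. (x - (\<Sum>a\<in>UNIV. c a *s X a)) v* flattening1 T = 0"
    using assms by (intro spanning_if_card_ge_rank) (simp_all add: vm_flattening1 tri_linear)
  then show ?thesis by (simp add: vm_flattening1 tri_linear)
qed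

lemma rank_flattening1_le:
  fixes f :: "'m::finite \<Rightarrow> 'a::field^'n1 \<Rightarrow> 'a"
  assumes lin: "\<And>a x x'. f a (x + x') = f a x + f a x'" "\<And>a c x. f a (c *s x) = c * f a x"
    and "\<And>x y z. (\<forall>a. f a x = 0) \<Longrightarrow> tri T x y z = 0"
  shows "rank (flattening1 T) \<le> CARD('m)"
proof (rule rank_le_card_if_kernel_subset)
  let ?F = "(\<chi> a i. f a (axis i 1)) :: 'a^'n1^'m"
  have "f a 0 = 0" for a using lin(2)[of a 0 0] by simp
  then have "f a (\<Sum>i\<in>S. g i) = (\<Sum>i\<in>S. f a (g i))" for a S and g :: "'n1 \<Rightarrow> _"
    by (induction S rule: infinite_finite_induct) (simp_all add: lin)
  then have "f a (\<Sum>i\<in>UNIV. x $ i *s axis i 1) = (?F *v x) $ a" for a x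
    by (simp add: lin matrix_vector_mult_def mult.commute)
  then have eq: "f a x = (?F *v x) $ a" for a x
    by (rule trans[OF arg_cong[OF vec_expand]])
  show "x v* flattening1 T = 0" if "?F *v x = 0" for x
  proof -
    have "f a x = 0" for a
      using eq[of a x] unfolding that by simp
    then show ?thesis unfolding vm_flattening1 by (intro allI assms(3)) blast
  qed
qed

lemma rank_flattening1_pos:
  assumes "T \<noteq> 0"
  shows "rank (flattening1 T) \<ge> 1"
proof (rule ccontr)
  assume "\<not> ?thesis"
  then have "x v* flattening1 T = 0" for x by (intro vector_matrix_mult_eq_0_if_rank_eq_0) simp
  then have "tri T x y z = 0" for x y z by (simp add: vm_flattening1)
  then have "T $ i $ j $ k = 0" for i j k by (simp add: tri_axis[symmetric])
  then show False using assms by (simp add: vec_eq_iff)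
qed

section \<open>Pencils of bilinear forms\<close>

lemma rank_flattening1_le_tri:
  fixes Y :: "'m::finite \<Rightarrow> 'a::field^'n2"
  assumes "\<And>x y z. (\<And>a. tri T x (Y a) (Z a) = 0) \<Longrightarrow> tri T x y z = 0"
  shows "rank (flattening1 T) \<le> CARD('m)"
  by (rule rank_flattening1_le[of "\<lambda>a x. tri T x (Y a) (Z a)"]) (auto simp: tri_linear intro: assms)

lemma rank_flattening1_le_1:
  assumes "\<And>x y z. tri T x y1 z1 = 0 \<Longrightarrow> tri T x y z = 0"
  shows "rank (flattening1 T) \<le> 1"
  using rank_flattening1_le_tri[of T "\<lambda>_::1. y1" "\<lambda>_. z1"] assms by simp

lemma rank_flattening1_le_2:
  assumes "\<And>x y z. tri T x y1 z1 = 0 \<Longrightarrow> tri T x y2 z2 = 0 \<Longrightarrow> tri T x y z = 0"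
  shows "rank (flattening1 T) \<le> 2"
proof -
  have "rank (flattening1 T) \<le> CARD(2)"
  proof (rule rank_flattening1_le_tri)
    fix x y z assume *: "\<And>a. tri T x (if a = (1::2) then y1 else y2) (if a = 1 then z1 else z2) = 0"
    have "tri T x y1 z1 = 0" "tri T x y2 z2 = 0"
      using *[of 1] *[of 2] by simp_all
    then show "tri T x y z = 0" by (rule assms)
  qed
  then show ?thesis by simp
qed

lemma rank_flattening1_le_3:
  assumes "\<And>x y z. tri T x y1 z1 = 0 \<Longrightarrow> tri T x y2 z2 = 0 \<Longrightarrow> tri T x y3 z3 = 0 \<Longrightarrow> tri T x y z = 0"
  shows "rank (flattening1 T) \<le> 3"
proof -
  have "rank (flattening1 T) \<le> CARD(3)"
  proof (rule rank_flattening1_le_tri)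
    fix x y z assume *: "\<And>a. tri T x (if a = (1::3) then y1 else if a = 2 then y2 else y3)
      (if a = 1 then z1 else if a = 2 then z2 else z3) = 0"
    have "tri T x y1 z1 = 0" "tri T x y2 z2 = 0" "tri T x y3 z3 = 0"
      using *[of 1] *[of 2] *[of 3] by simp_all
    then show "tri T x y z = 0" by (rule assms)
  qed
  then show ?thesis by simp
qed

text \<open>A single evaluation functional cannot cut out the kernel of \<open>T\<close> if the rank
  exceeds one, so some \<open>x\<close> outside this kernel is annihilated by it.\<close>

lemma rank_flattening1_ge_2E:
  assumes "rank (flattening1 T) \<ge> 2"
  obtains x y z where "tri T x y1 z1 = 0" "tri T x y z \<noteq> 0"
  using rank_flattening1_le_1[of T y1 z1] assms by fastforce

lemma rank_flattening1_ge_3E: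
  assumes "rank (flattening1 T) \<ge> 3"
  obtains x y z where "tri T x y1 z1 = 0" "tri T x y2 z2 = 0" "tri T x y z \<noteq> 0"
  using rank_flattening1_le_2[of T y1 z1 y2 z2] assms by fastforce

section \<open>Bilinear forms and their two-by-two blocks\<close>

definition bil :: "('a::field^'n \<Rightarrow> 'a^'m \<Rightarrow> 'a) \<Rightarrow> bool" where
  "bil E \<longleftrightarrow> (\<forall>y y' z. E (y + y') z = E y z + E y' z) \<and> (\<forall>c y z. E (c *s y) z = c * E y z) \<and>
    (\<forall>y z z'. E y (z + z') = E y z + E y z') \<and> (\<forall>c y z. E y (c *s z) = c * E y z)"

lemma bil_simps:
  assumes "bil E"
  shows "E (y + y') z = E y z + E y' z" "E (c *s y) z = c * E y z"
    "E y (z + z') = E y z + E y z'" "E y (c *s z) = c * E y z"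
    "E (y - y') z = E y z - E y' z" "E y (z - z') = E y z - E y z'"
proof -
  show 1: "E (y + y') z = E y z + E y' z" "E y (z + z') = E y z + E y z'" for y y' z z'
    using assms unfolding bil_def by blast+
  show "E (c *s y) z = c * E y z" "E y (c *s z) = c * E y z"
    using assms unfolding bil_def by blast+
  show "E (y - y') z = E y z - E y' z" "E y (z - z') = E y z - E y z'"
    using 1(1)[of "y - y'" y' z] 1(2)[of y "z - z'" z'] by (simp_all only: diff_add_cancel eq_diff_eq)
qed

lemma bil_tri: "bil (tri T x)"
  by (simp add: bil_def tri_linear)

lemma bil_flip: "bil E \<Longrightarrow> bil (\<lambda>z y. E y z)"
  by (simp add: bil_def)

definition dual_pairs :: "('y \<Rightarrow> 'z \<Rightarrow> 'a::field) \<Rightarrow> 'y \<Rightarrow> 'y \<Rightarrow> 'z \<Rightarrow> 'z \<Rightarrow> bool" where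
  "dual_pairs E y1 y2 z1 z2 \<longleftrightarrow> E y1 z1 = 1 \<and> E y1 z2 = 0 \<and> E y2 z1 = 0 \<and> E y2 z2 = 1"

text \<open>
  The pencil spanned by \<open>E\<close> and \<open>M\<close> has a \<open>2 \<times> 2\<close> block that is diagonalizable with two distinct eigenvalues;
  the condition is homogeneous, so that the eigenvalue \<open>\<infinity>\<close> is included.
\<close>

definition splits :: "('y \<Rightarrow> 'z \<Rightarrow> 'a::field) \<Rightarrow> ('y \<Rightarrow> 'z \<Rightarrow> 'a) \<Rightarrow> bool" where
  "splits E M \<longleftrightarrow> (\<exists>y1 y2 z1 z2. E y1 z2 = 0 \<and> E y2 z1 = 0 \<and> M y1 z2 = 0 \<and> M y2 z1 = 0 \<and>
    E y1 z1 * M y2 z2 \<noteq> E y2 z2 * M y1 z1)"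

lemma splitsI:
  assumes "E y1 z2 = 0" "E y2 z1 = 0" "M y1 z2 = 0" "M y2 z1 = 0" "E y1 z1 * M y2 z2 \<noteq> E y2 z2 * M y1 z1"
  shows "splits E M"
  unfolding splits_def using assms by blast

lemma splits_flip: "splits (\<lambda>z y. E y z) (\<lambda>z y. M y z) \<longleftrightarrow> splits E M"
  unfolding splits_def by blast

text \<open>Both forms are diagonal on the block, and \<open>d\<close> is the determinant of the
  matrix of their diagonal entries. Cramer's rule recombines \<open>x\<close> and \<open>x'\<close>
  into slices with a single diagonal entry 1.\<close>

lemma restricts_to_I_if_splits:
  assumes "splits (tri T x) (tri T x')"
  shows "T \<ge>\<^sub>t I_tensor"
proof -
  obtain y1 y2 z1 z2 where 0: "tri T x y1 z2 = 0" "tri T x y2 z1 = 0" "tri T x' y1 z2 = 0" "tri T x' y2 z1 = 0"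
    and ne: "tri T x y1 z1 * tri T x' y2 z2 \<noteq> tri T x y2 z2 * tri T x' y1 z1"
    using assms unfolding splits_def by blast
  define d where "d = tri T x y1 z1 * tri T x' y2 z2 - tri T x y2 z2 * tri T x' y1 z1"
  have d: "d \<noteq> 0" using ne by (simp add: d_def)
  define x1 x2 where x: "x1 = inverse d *s (tri T x' y2 z2 *s x - tri T x y2 z2 *s x')"
    "x2 = inverse d *s (tri T x y1 z1 *s x' - tri T x' y1 z1 *s x)"
  have "tri T x1 y1 z1 = inverse d * (tri T x' y2 z2 * tri T x y1 z1 - tri T x y2 z2 * tri T x' y1 z1)"
    by (simp add: x tri_linear right_diff_distrib)
  moreover have "tri T x2 y2 z2 = inverse d * (tri T x y1 z1 * tri T x' y2 z2 - tri T x' y1 z1 * tri T x y2 z2)"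
    by (simp add: x tri_linear right_diff_distrib)
  ultimately have 1: "tri T x1 y1 z1 = 1" "tri T x2 y2 z2 = 1"
    using d by (simp_all add: d_def mult.commute)
  have 2: "tri T x1 y2 z2 = 0" "tri T x2 y1 z1 = 0"
    by (simp_all add: x tri_linear)
  have 3: "tri T x1 y1 z2 = 0" "tri T x1 y2 z1 = 0" "tri T x2 y1 z2 = 0" "tri T x2 y2 z1 = 0"
    by (simp_all add: x tri_linear 0)
  show ?thesis
  proof (rule restricts_toI[of T "\<lambda>a. if a = 1 then x1 else x2" "\<lambda>b. if b = 1 then y1 else y2"
      "\<lambda>c. if c = 1 then z1 else z2"])
    fix a b c :: 2
    show "tri T (if a = 1 then x1 else x2) (if b = 1 then y1 else y2) (if c = 1 then z1 else z2)
      = I_tensor $ a $ b $ c"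
      using exhaust_2[of a] exhaust_2[of b] exhaust_2[of c]
      by (elim disjE; simp add: 1 2 3 I_tensor_def basis_tensor_nth)
  qed
qed

lemma splits_if_singular_aux:
  assumes E: "bil E" and M: "bil M" and u: "dual_pairs E y1 y2 z1 z2"
    and det: "M y1 z1 * M y2 z2 = M y1 z2 * M y2 z1" and tr: "M y1 z1 + M y2 z2 \<noteq> 0"
    and ne: "M y1 z1 \<noteq> 0"
  shows "splits E M"
proof -
  define p q r s where d: "p = M y1 z1" "q = M y1 z2" "r = M y2 z1" "s = M y2 z2"
  have ps: "p * s = q * r" and ps0: "p + s \<noteq> 0" "p \<noteq> 0" using det tr ne by (simp_all add: d)
  note lin = bil_simps[OF E] bil_simps[OF M]
  \<comment> \<open>The block with rows \<open>(p, q)\<close> and \<open>(r, s)\<close> has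
    eigenvalues \<open>p + s\<close> and 0. These are its left eigenvectors \<open>(p, q)\<close>,
    \<open>(-r, p)\<close> and its right eigenvectors \<open>(p, r)\<close>,
    \<open>(-q, p)\<close>.\<close>
  let ?y1 = "p *s y1 + q *s y2" and ?z1 = "p *s z1 + r *s z2"
    and ?y2 = "(-r) *s y1 + p *s y2" and ?z2 = "(-q) *s z1 + p *s z2"
  have e: "E y1 z1 = 1" "E y1 z2 = 0" "E y2 z1 = 0" "E y2 z2 = 1"
    using u by (auto simp: dual_pairs_def)
  have m: "M ?y1 ?z1 = p * (p + s)\<^sup>2"
    unfolding lin d[symmetric] using ps by algebra
  have m2: "M ?y2 ?z2 = 0" unfolding lin d[symmetric] using ps by algebra
  have m3: "M ?y1 ?z2 = 0" unfolding lin d[symmetric] using ps by algebra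
  have m4: "M ?y2 ?z1 = 0" unfolding lin d[symmetric] using ps by algebra
  have e2: "E ?y2 ?z2 = p * (p + s)" unfolding lin e using ps by algebra
  have e3: "E ?y1 ?z2 = 0" unfolding lin e by simp
  have e4: "E ?y2 ?z1 = 0" unfolding lin e by simp
  have "E ?y1 ?z1 * M ?y2 ?z2 \<noteq> E ?y2 ?z2 * M ?y1 ?z1"
    unfolding m m2 e2 using ps0 by simp
  with e3 e4 m3 m4 show ?thesis by (rule splitsI)
qed

lemma splits_if_singular:
  assumes E: "bil E" and M: "bil M" and u: "dual_pairs E y1 y2 z1 z2"
    and det: "M y1 z1 * M y2 z2 = M y1 z2 * M y2 z1" and tr: "M y1 z1 + M y2 z2 \<noteq> 0"
  shows "splits E M"
proof (cases "M y1 z1 = 0")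
  case True
  then have "M y2 z2 \<noteq> 0" using tr by auto
  moreover have "dual_pairs E y2 y1 z2 z1" using u by (auto simp: dual_pairs_def)
  moreover have "M y2 z2 * M y1 z1 = M y2 z1 * M y1 z2" "M y2 z2 + M y1 z1 \<noteq> 0"
    using det tr by (simp_all add: mult.commute add.commute)
  ultimately show ?thesis using splits_if_singular_aux[OF E M] by blast
qed (use splits_if_singular_aux assms in blast)

lemma splits_if_zero_block_aux:
  assumes E: "bil E" and M: "bil M" and u: "dual_pairs E y1 y2 z1 z2"
    and 0: "M y1 z1 = 0" "M y1 z2 = 0" "M y2 z1 = 0" "M y2 z2 = 0"
    and ne: "M y1 z \<noteq> 0 \<or> M y2 z \<noteq> 0"
  shows "splits E M"
proof -
  note lin = bil_simps[OF E] bil_simps[OF M]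
  \<comment> \<open>\<open>?z\<close> is \<open>z\<close> made orthogonal to \<open>y1\<close> and
    \<open>y2\<close> under \<open>E\<close>; its values under \<open>M\<close> there are unchanged
    since the block of \<open>M\<close> vanishes. Adding it to \<open>z1\<close> or
    \<open>z2\<close> keeps the pairs dual and gives \<open>M\<close> a singular block with nonzero
    trace.\<close>
  let ?z = "z + (- E y1 z) *s z1 + (- E y2 z) *s z2"
  have e: "E y1 z1 = 1" "E y1 z2 = 0" "E y2 z1 = 0" "E y2 z2 = 1"
    using u by (auto simp: dual_pairs_def)
  show ?thesis
  proof (cases "M y1 z = 0")
    case False
    then show ?thesis
      by (intro splits_if_singular[OF E M, of y1 y2 "z1 + ?z" z2]) (simp_all add: lin e 0 dual_pairs_def)
  next
    case True
    then show ?thesis using ne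
      by (intro splits_if_singular[OF E M, of y1 y2 z1 "z2 + ?z"]) (simp_all add: lin e 0 dual_pairs_def)
  qed
qed

lemma splits_if_zero_block:
  assumes E: "bil E" and M: "bil M" and u: "dual_pairs E y1 y2 z1 z2"
    and 0: "M y1 z1 = 0" "M y1 z2 = 0" "M y2 z1 = 0" "M y2 z2 = 0"
    and ne: "M y z \<noteq> 0"
  shows "splits E M"
proof -
  note lin = bil_simps[OF E] bil_simps[OF M]
  have e: "E y1 z1 = 1" "E y1 z2 = 0" "E y2 z1 = 0" "E y2 z2 = 1"
    using u by (auto simp: dual_pairs_def)
  consider "M y1 z \<noteq> 0 \<or> M y2 z \<noteq> 0" | "M y z1 \<noteq> 0 \<or> M y z2 \<noteq> 0"
    | "M y1 z = 0" "M y2 z = 0" "M y z1 = 0" "M y z2 = 0" by blast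
  then show ?thesis
  proof cases
    case 1
    then show ?thesis using splits_if_zero_block_aux[OF E M u 0] by blast
  next
    case 2
    have *: "dual_pairs (\<lambda>z y. E y z) z1 z2 y1 y2" using u by (auto simp: dual_pairs_def)
    have "splits (\<lambda>z y. E y z) (\<lambda>z y. M y z)"
      by (rule splits_if_zero_block_aux[OF bil_flip[OF E] bil_flip[OF M] * 0(1) 0(3) 0(2) 0(4) 2])
    then show ?thesis by (rule iffD1[OF splits_flip])
  next
    case 3
    \<comment> \<open>Now \<open>y\<close> and \<open>z\<close>, made orthogonal to the block under
      \<open>E\<close>, are also orthogonal to it under \<open>M\<close>. The block on
      \<open>y1, ?y\<close> and \<open>z1, ?z\<close> is diagonal, and \<open>M\<close> vanishes
      only at its first diagonal position.\<close>
    let ?z = "z + (- E y1 z) *s z1 + (- E y2 z) *s z2"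
    let ?y = "y + (- E y z1) *s y1 + (- E y z2) *s y2"
    show ?thesis
      by (rule splitsI[of E y1 ?z ?y z1]) (use ne in \<open>simp_all add: lin e 0 3\<close>)
  qed
qed

definition jordan_block :: "('y \<Rightarrow> 'z \<Rightarrow> 'a::field) \<Rightarrow> 'y \<Rightarrow> 'y \<Rightarrow> 'z \<Rightarrow> 'z \<Rightarrow> bool" where
  "jordan_block M y1 y2 z1 z2 \<longleftrightarrow> M y1 z1 = 0 \<and> M y1 z2 = 1 \<and> M y2 z1 = 0 \<and> M y2 z2 = 0"

text \<open>If \<open>M\<close> links \<open>y\<close> or the corrected \<open>?z\<close> to the
  block, a small change of one of the four vectors keeps the pairs dual and gives the singular block
  trace 1 (cases 1 to 4). Otherwise the pair \<open>y, ?z\<close> is a direct summand and is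
  combined with part of the block.\<close>

lemma splits_if_jordan_block_extends:
  assumes E: "bil E" and M: "bil M" and u: "dual_pairs E y1 y2 z1 z2"
    and j: "jordan_block M y1 y2 z1 z2"
    and y: "E y z1 = 0" "E y z2 = 0" and ne: "E y z \<noteq> 0 \<or> M y z \<noteq> 0"
  shows "splits E M"
proof -
  note lin = bil_simps[OF E] bil_simps[OF M]
  have e: "E y1 z1 = 1" "E y1 z2 = 0" "E y2 z1 = 0" "E y2 z2 = 1"
    and m: "M y1 z1 = 0" "M y1 z2 = 1" "M y2 z1 = 0" "M y2 z2 = 0"
    using u j by (auto simp: dual_pairs_def jordan_block_def)
  let ?z = "z + (- E y1 z) *s z1 + (- E y2 z) *s z2"
  consider "M y z1 \<noteq> 0" | "M y z1 = 0" "M y z2 \<noteq> 0"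
    | "M y z1 = 0" "M y z2 = 0" "M y2 ?z \<noteq> 0"
    | "M y z1 = 0" "M y z2 = 0" "M y2 ?z = 0" "M y1 ?z \<noteq> 0"
    | "M y z1 = 0" "M y z2 = 0" "M y2 ?z = 0" "M y1 ?z = 0" by blast
  then show ?thesis
  proof cases
    case 1
    then show ?thesis
      by (intro splits_if_singular[OF E M, of "y1 + inverse (M y z1) *s y" y2 z1 z2])
        (simp_all add: lin e m y dual_pairs_def)
  next
    case 2
    then show ?thesis
      by (intro splits_if_singular[OF E M, of y1 "y2 + inverse (M y z2) *s y" z1 z2])
        (simp_all add: lin e m y dual_pairs_def)
  next
    case 3
    moreover have "E y1 ?z = 0" "E y2 ?z = 0" by (simp_all add: lin e)
    ultimately show ?thesis
      by (intro splits_if_singular[OF E M, of y1 y2 z1 "z2 + inverse (M y2 ?z) *s ?z"])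
        (simp_all add: lin e m dual_pairs_def)
  next
    case 4
    moreover have "E y1 ?z = 0" "E y2 ?z = 0" by (simp_all add: lin e)
    ultimately show ?thesis
      by (intro splits_if_singular[OF E M, of y1 y2 "z1 + inverse (M y1 ?z) *s ?z" z2])
        (simp_all add: lin e m dual_pairs_def)
  next
    case 5
    have z: "E y1 ?z = 0" "E y2 ?z = 0" "E y ?z = E y z" "M y ?z = M y z"
      by (simp_all add: lin e y 5)
    show ?thesis
    proof (cases "M y z = 0")
      case False
      then have "E y1 z1 * M y ?z \<noteq> E y ?z * M y1 z1" using z(4) e m by simp
      with z(1) y(1) 5(4) 5(1) show ?thesis by (rule splitsI)
    next
      case True
      \<comment> \<open>Here \<open>E y z\<close> is nonzero. Replacing \<open>z1\<close> by
        \<open>z1 + z2\<close> makes \<open>M\<close> nonzero on \<open>y1\<close>, so the two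
        diagonal ratios differ.\<close>
      then have *: "E y1 (z1 + z2) * M y ?z \<noteq> E y ?z * M y1 (z1 + z2)"
        unfolding z using ne e m by (simp add: lin)
      have "E y (z1 + z2) = 0" "M y (z1 + z2) = 0" using y 5 by (simp_all add: lin)
      from z(1) this(1) 5(4) this(2) * show ?thesis by (rule splitsI)
    qed
  qed
qed

lemma jordan_block_exists_aux:
  assumes E: "bil E" and M: "bil M" and u: "dual_pairs E y1 y2 z1 z2"
    and det: "M y1 z1 * M y2 z2 = M y1 z2 * M y2 z1" and tr: "M y1 z1 + M y2 z2 = 0"
    and ne: "M y1 z2 \<noteq> 0"
  shows "\<exists>y1 y2 z1 z2. dual_pairs E y1 y2 z1 z2 \<and> jordan_block M y1 y2 z1 z2"
proof -
  define p q r s where d: "p = M y1 z1" "q = M y1 z2" "r = M y2 z1" "s = M y2 z2"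
  have s: "s = - p" and q: "q \<noteq> 0" using tr ne by (simp_all add: d add_eq_0_iff)
  have ps: "q * r = - (p * p)" using det unfolding d[symmetric] s by simp
  note lin = bil_simps[OF E] bil_simps[OF M]
  have e: "E y1 z1 = 1" "E y1 z2 = 0" "E y2 z1 = 0" "E y2 z2 = 1"
    using u by (auto simp: dual_pairs_def)
  \<comment> \<open>The block is nilpotent, so \<open>?y2\<close>, the left image of
    \<open>y1\<close>, lies in its left kernel; \<open>?z1, ?z2\<close> is the basis dual to
    \<open>y1, ?y2\<close>, and \<open>?z1\<close> lies in the right kernel.\<close>
  let ?y2 = "p *s y1 + q *s y2" and ?z1 = "z1 + (- p / q) *s z2" and ?z2 = "inverse q *s z2"
  have "dual_pairs E y1 ?y2 ?z1 ?z2"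
    using q by (simp add: dual_pairs_def lin e)
  moreover have "M y1 ?z1 = 0" "M y1 ?z2 = 1" unfolding lin d[symmetric] using q by simp_all
  moreover have "M ?y2 ?z1 = 0" "M ?y2 ?z2 = 0" unfolding lin d[symmetric] s using q ps by (simp_all add: field_simps)
  ultimately show ?thesis unfolding jordan_block_def by blast
qed

lemma jordan_block_exists:
  assumes E: "bil E" and M: "bil M" and u: "dual_pairs E y1 y2 z1 z2"
    and det: "M y1 z1 * M y2 z2 = M y1 z2 * M y2 z1" and tr: "M y1 z1 + M y2 z2 = 0"
    and ne: "\<not> (M y1 z1 = 0 \<and> M y1 z2 = 0 \<and> M y2 z1 = 0 \<and> M y2 z2 = 0)"
  shows "\<exists>y1 y2 z1 z2. dual_pairs E y1 y2 z1 z2 \<and> jordan_block M y1 y2 z1 z2"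
proof (cases "M y1 z2 = 0")
  case True
  then have "M y2 z1 \<noteq> 0" using ne det tr by (auto simp: add_eq_0_iff)
  moreover have "dual_pairs E y2 y1 z2 z1" using u by (auto simp: dual_pairs_def)
  moreover have "M y2 z2 * M y1 z1 = M y2 z1 * M y1 z2" "M y2 z2 + M y1 z1 = 0"
    using det tr by (simp_all add: mult.commute add.commute)
  ultimately show ?thesis using jordan_block_exists_aux[OF E M] by blast
qed (use jordan_block_exists_aux assms in blast)

section \<open>Tensors with a flattening of rank two\<close>

lemma dual_pairs_exist:
  assumes E: "bil E" and ne: "E y1 z1 * E y2 z2 \<noteq> E y1 z2 * E y2 z1"
  shows "\<exists>y1 y2. dual_pairs E y1 y2 z1 z2"
proof -
  define d where "d = E y1 z1 * E y2 z2 - E y1 z2 * E y2 z1"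
  have d: "d \<noteq> 0" using ne by (simp add: d_def)
  have "E (inverse d *s (E y2 z2 *s y1 - E y1 z2 *s y2)) z1 = inverse d * d"
    "E (inverse d *s (E y1 z1 *s y2 - E y2 z1 *s y1)) z2 = inverse d * d"
    unfolding bil_simps[OF E] d_def by (simp_all add: mult.commute)
  moreover have "E (inverse d *s (E y2 z2 *s y1 - E y1 z2 *s y2)) z2 = 0"
    "E (inverse d *s (E y1 z1 *s y2 - E y2 z1 *s y1)) z1 = 0"
    unfolding bil_simps[OF E] by (simp_all add: mult.commute)
  ultimately show ?thesis using d unfolding dual_pairs_def by (metis left_inverse)
qed

text \<open>A linear space of matrices of rank at most one has a common row or column direction,
  which would force \<open>flattening2\<close> or \<open>flattening3\<close> to have rank at most
  one.\<close>

lemma rank_2_slice_exists: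
  assumes T: "T \<noteq> 0" and r2: "rank (flattening2 T) \<ge> 2" and r3: "rank (flattening3 T) \<ge> 2"
  shows "\<exists>x y1 y2 z1 z2. dual_pairs (tri T x) y1 y2 z1 z2"
proof (rule ccontr)
  assume no: "\<not> ?thesis"
  have H: "tri T x y z * tri T x y' z' = tri T x y z' * tri T x y' z" for x y y' z z'
    using no dual_pairs_exist[OF bil_tri] by blast
  obtain x0 y0' z0 where 0: "tri T x0 y0' z0 \<noteq> 0"
    using T by (metis tri_axis vec_eq_iff zero_index)
  define y0 where "y0 = inverse (tri T x0 y0' z0) *s y0'"
  have 1: "tri T x0 y0 z0 = 1" using 0 by (simp add: y0_def tri_linear)
  have F: "tri T x y z = 0" "tri T x y0 z * tri T x y z0 = 0"
    if y: "tri T x0 y z0 = 0" and z: "tri T x0 y0 z = 0" for x y z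
  proof -
    have yz: "tri T x0 y z = 0" using H[of x0 y0 z0 y z] 1 y z by simp
    show "tri T x y z = 0"
      using H[of x y0 z0 y z] H[of "x0 + x" y0 z0 y z] by (simp add: tri_linear 1 y z yz algebra_simps)
    then show "tri T x y0 z * tri T x y z0 = 0" using H[of x y0 z0 y z] by simp
  qed
  obtain y1 x1 z1 where y1: "tri T x0 y1 z0 = 0" "tri T x1 y1 z1 \<noteq> 0"
    using rank_flattening1_ge_2E[of "swap12 T" x0 z0] r2 by (auto simp: rank_flattening_swap12)
  have "tri T x1 y1 (z1 - tri T x0 y0 z1 *s z0) = 0"
    by (rule F(1)[OF y1(1)]) (simp add: tri_linear 1)
  then have c: "tri T x1 y1 z0 \<noteq> 0" using y1(2) by (auto simp: tri_linear)
  obtain z2 x2 y2 where z2: "tri T x0 y0 z2 = 0" "tri T x2 y2 z2 \<noteq> 0"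
    using rank_flattening1_ge_2E[of "swap12 (swap23 T)" x0 y0] r3
    by (auto simp: rank_flattening_swap12 rank_flattening_swap23)
  have "tri T x2 (y2 - tri T x0 y2 z0 *s y0) z2 = 0"
    by (rule F(1)[OF _ z2(1)]) (simp add: tri_linear 1)
  then have b: "tri T x2 y0 z2 \<noteq> 0" using z2(2) by (auto simp: tri_linear)
  \<comment> \<open>By \<open>F(2)\<close> a product of two linear functionals of \<open>x\<close>
    vanishes identically. Each factor is nonzero at one of \<open>x1\<close>, \<open>x2\<close>,
    hence both are nonzero at \<open>x1 + x2\<close>.\<close>
  have "tri T x1 y0 z2 = 0" "tri T x2 y1 z0 = 0"
    using F(2)[OF y1(1) z2(1), of x1] F(2)[OF y1(1) z2(1), of x2] b c by auto
  then show False using F(2)[OF y1(1) z2(1), of "x1 + x2"] b c by (simp add: tri_linear)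
qed

lemma singular_shift_exists:
  fixes p q r s :: "'a::alg_closed_field"
  shows "\<exists>l. (p - l) * (s - l) = q * r"
proof -
  \<comment> \<open>This is the characteristic polynomial of the block.\<close>
  have "degree [:p * s - q * r, - (p + s), 1:] > 0" by simp
  from alg_closed_imp_poly_has_root[OF this] obtain l where "poly [:p * s - q * r, - (p + s), 1:] l = 0" ..
  then have "(p - l) * (s - l) = q * r" by (simp add: algebra_simps)
  then show ?thesis ..
qed

lemma restricts_to_W_if_jordan_block:
  assumes "dual_pairs (tri T x) y1 y2 z1 z2" "jordan_block (tri T x') y1 y2 z1 z2"
  shows "T \<ge>\<^sub>t W_tensor"
\<comment> \<open>The order \<open>z2, z1\<close> turns the identity slice into the antidiagonal
  slice of \<open>W_tensor\<close>, and the Jordan entry into its corner entry.\<close>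
proof (rule restricts_toI[of T "\<lambda>a. if a = 1 then x else x'" "\<lambda>b. if b = 1 then y1 else y2"
      "\<lambda>c. if c = 1 then z2 else z1"])
  fix a b c :: 2
  show "tri T (if a = 1 then x else x') (if b = 1 then y1 else y2) (if c = 1 then z2 else z1)
      = W_tensor $ a $ b $ c"
    using exhaust_2[of a] exhaust_2[of b] exhaust_2[of c] assms unfolding dual_pairs_def jordan_block_def
    by (elim disjE; simp add: W_tensor_def basis_tensor_nth)
qed

lemma I_or_W_if_rank_flattening1_2:
  fixes T :: "('a::alg_closed_field, 'n1::finite, 'n2::finite, 'n3::finite) tensor"
  assumes r1: "rank (flattening1 T) = 2" and r2: "rank (flattening2 T) \<ge> 2" and r3: "rank (flattening3 T) \<ge> 2"
  shows "T \<ge>\<^sub>t I_tensor \<or>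
    (T \<ge>\<^sub>t W_tensor \<and> rank (flattening2 T) \<le> 2 \<and> rank (flattening3 T) \<le> 2)"
proof (cases "\<exists>x x'. splits (tri T x) (tri T x')")
  case True
  then show ?thesis using restricts_to_I_if_splits by blast
next
  case False
  have "tri T x y z = 0" if "T = 0" for x y z using that by (simp add: tri_def)
  then have "T \<noteq> 0"
    using r1 rank_flattening1_le_1[of T 0 0] by force
  then obtain x y1 y2 z1 z2 where u: "dual_pairs (tri T x) y1 y2 z1 z2"
    using rank_2_slice_exists r2 r3 by blast
  obtain x' y z where x': "tri T x' y1 z1 = 0" "tri T x' y z \<noteq> 0"
    using rank_flattening1_ge_2E[of T y1 z1] r1 by auto
  obtain l where l: "(tri T x' y1 z1 - l) * (tri T x' y2 z2 - l) = tri T x' y1 z2 * tri T x' y2 z1"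
    using singular_shift_exists by blast
  let ?m = "x' - l *s x"
  note b = bil_tri[of T x] bil_tri[of T ?m]
  have e: "tri T x y1 z1 = 1" "tri T x y1 z2 = 0" "tri T x y2 z1 = 0" "tri T x y2 z2 = 1"
    using u by (auto simp: dual_pairs_def)
  have det: "tri T ?m y1 z1 * tri T ?m y2 z2 = tri T ?m y1 z2 * tri T ?m y2 z1"
    using l by (simp add: tri_linear e)
  have tr: "tri T ?m y1 z1 + tri T ?m y2 z2 = 0"
    using splits_if_singular[OF b u det] False by blast
  \<comment> \<open>The slice at \<open>x'\<close> is nonzero but vanishes at
    \<open>(y1, z1)\<close>, where the slice at \<open>x\<close> is 1, so it is no multiple of the
    latter.\<close>
  have "\<exists>y z. tri T ?m y z \<noteq> 0"
  proof (rule ccontr)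
    assume "\<not> ?thesis"
    then have "tri T x' y z = l * tri T x y z" for y z by (simp add: tri_linear)
    then show False using x' e(1) by (metis mult_zero_left mult.right_neutral)
  qed
  then have "\<not> (tri T ?m y1 z1 = 0 \<and> tri T ?m y1 z2 = 0 \<and> tri T ?m y2 z1 = 0 \<and> tri T ?m y2 z2 = 0)"
    using splits_if_zero_block[OF b u] False by blast
  then obtain y1 y2 z1 z2 where u: "dual_pairs (tri T x) y1 y2 z1 z2"
    and j: "jordan_block (tri T ?m) y1 y2 z1 z2"
    using jordan_block_exists[OF b u det tr] by blast
  have span: "\<exists>c :: 2 \<Rightarrow> 'a. \<forall>y z. tri T w y z = c 1 * tri T x y z + c 2 * tri T ?m y z" for w
  proof -
    let ?X = "\<lambda>a::2. if a = 1 then x else ?m"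
    have "\<exists>c. \<forall>y z. tri T w y z = (\<Sum>a\<in>UNIV. c a * tri T (?X a) y z)"
    proof (rule spanning_flattening1)
      fix c :: "2 \<Rightarrow> 'a" assume *: "\<And>y z. (\<Sum>a\<in>UNIV. c a * tri T (?X a) y z) = 0"
      have "c 1 = 0" "c 2 = 0"
        using *[of y1 z1] *[of y1 z2] u j by (simp_all add: sum_2 dual_pairs_def jordan_block_def)
      then show "\<forall>a. c a = 0" by (simp add: forall_2)
    qed (simp add: r1)
    then show ?thesis by (simp add: sum_2)
  qed
  have ne: "tri T x y z \<noteq> 0 \<or> tri T ?m y z \<noteq> 0" if "tri T w y z \<noteq> 0" for w y z
    using span[of w] that by (metis add.right_neutral mult_zero_right)
  have "rank (flattening2 T) \<le> 2"
  proof (rule ccontr)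
    assume "\<not> ?thesis"
    then obtain y w z where y: "tri T x y z1 = 0" "tri T x y z2 = 0" "tri T w y z \<noteq> 0"
      using rank_flattening1_ge_3E[of "swap12 T" x z1 x z2] by (auto simp: rank_flattening_swap12)
    have "splits (tri T x) (tri T ?m)"
      by (rule splits_if_jordan_block_extends[OF b u j y(1,2) ne[OF y(3)]])
    then show False using False by blast
  qed
  moreover have "rank (flattening3 T) \<le> 2"
  proof (rule ccontr)
    assume "\<not> ?thesis"
    then obtain z w y where z: "tri T x y1 z = 0" "tri T x y2 z = 0" "tri T w y z \<noteq> 0"
      using rank_flattening1_ge_3E[of "swap12 (swap23 T)" x y1 x y2]
      by (auto simp: rank_flattening_swap12 rank_flattening_swap23)
    have "splits (\<lambda>z y. tri T x y z) (\<lambda>z y. tri T ?m y z)"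
      \<comment> \<open>Transposition moves the entry 1 below the diagonal; reversing the order of
        both pairs moves it back.\<close>
      by (rule splits_if_jordan_block_extends[OF b[THEN bil_flip], of z2 z1 y2 y1 z y])
        (use u j z ne[OF z(3)] in \<open>auto simp: dual_pairs_def jordan_block_def\<close>)
    then have "splits (tri T x) (tri T ?m)" by (rule iffD1[OF splits_flip])
    then show False using False by blast
  qed
  ultimately show ?thesis using restricts_to_W_if_jordan_block[OF u j] by blast
qed

lemma swap_I_W [simp]:
  "swap12 I_tensor = I_tensor" "swap23 I_tensor = I_tensor"
  "swap12 W_tensor = W_tensor" "swap23 W_tensor = W_tensor"
  by (simp_all add: vec_eq_iff forall_2 I_tensor_def W_tensor_def basis_tensor_nth)

lemma I_or_W_if_rank_flattening2_2:
  fixes T :: "('a::alg_closed_field, 'n1::finite, 'n2::finite, 'n3::finite) tensor"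
  assumes "rank (flattening2 T) = 2" "rank (flattening1 T) \<ge> 2" "rank (flattening3 T) \<ge> 2"
  shows "T \<ge>\<^sub>t I_tensor \<or>
    (T \<ge>\<^sub>t W_tensor \<and> rank (flattening1 T) \<le> 2 \<and> rank (flattening3 T) \<le> 2)"
  using I_or_W_if_rank_flattening1_2[of "swap12 T"] restricts_to_swapI(1)[of "swap12 T"] assms
  by (fastforce simp: rank_flattening_swap12)

lemma I_or_W:
  fixes T :: "('a::alg_closed_field, 'n1::finite, 'n2::finite, 'n3::finite) tensor"
  assumes "rank (flattening1 T) \<ge> 2" "rank (flattening2 T) \<ge> 2" "rank (flattening3 T) \<ge> 2"
    and "rank (flattening1 T) = 2 \<or> rank (flattening2 T) = 2 \<or> rank (flattening3 T) = 2"
  shows "T \<ge>\<^sub>t I_tensor \<or> (T \<ge>\<^sub>t W_tensor \<and>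
    rank (flattening1 T) = 2 \<and> rank (flattening2 T) = 2 \<and> rank (flattening3 T) = 2)"
proof -
  have "T \<ge>\<^sub>t I_tensor \<or> (T \<ge>\<^sub>t W_tensor \<and> rank (flattening1 T) \<le> 2 \<and> rank (flattening2 T) \<le> 2)"
    if "rank (flattening3 T) = 2"
    using I_or_W_if_rank_flattening2_2[of "swap23 T"] restricts_to_swapI(2)[of "swap23 T"] assms that
    by (fastforce simp: rank_flattening_swap23)
  then show ?thesis
    using assms I_or_W_if_rank_flattening1_2[of T] I_or_W_if_rank_flattening2_2[of T] by linarith
qed

text \<open>The determinant of a restricted slice is a constant times the square of a linear form
  for \<open>W_tensor\<close>, but the product of two independent linear forms for
  \<open>I_tensor\<close>. The values at \<open>X 1\<close>, \<open>X 2\<close> and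
  \<open>X 1 + X 2\<close> separate these in every characteristic.\<close>

lemma not_W_restricts_to_I: "\<not> W_tensor \<ge>\<^sub>t I_tensor"
proof
  assume "(W_tensor :: ('a::field, 2, 2, 2) tensor) \<ge>\<^sub>t I_tensor"
  then obtain X Y Z :: "2 \<Rightarrow> 'a^2" where *: "\<And>a b c. tri W_tensor (X a) (Y b) (Z c) = I_tensor $ a $ b $ c"
    unfolding restricts_to_iff by blast
  have W: "tri W_tensor x y z = x $ 1 * y $ 1 * z $ 2 + x $ 1 * y $ 2 * z $ 1 + x $ 2 * y $ 1 * z $ 1"
    for x y z :: "'a^2"
    by (simp add: W_tensor_def tri_tensor_add tri_basis_tensor)
  let ?k = "(Y 1 $ 1 * Y 2 $ 2 - Y 1 $ 2 * Y 2 $ 1) * (Z 1 $ 1 * Z 2 $ 2 - Z 1 $ 2 * Z 2 $ 1)"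
  let ?D = "\<lambda>x. tri W_tensor x (Y 1) (Z 1) * tri W_tensor x (Y 2) (Z 2)
      - tri W_tensor x (Y 1) (Z 2) * tri W_tensor x (Y 2) (Z 1)"
  have D: "?D x = - (?k * (x $ 1)\<^sup>2)" for x
    unfolding W by algebra
  have I: "tri W_tensor (X a) (Y b) (Z c) = of_bool (a = b \<and> b = c)" for a b c
    unfolding * using exhaust_2[of a] exhaust_2[of b] exhaust_2[of c]
    by (elim disjE; simp add: I_tensor_def basis_tensor_nth)
  have "?D (X 1) = 0" "?D (X 2) = 0" "?D (X 1 + X 2) = 1"
    by (simp_all add: tri_add I)
  then have "?k * (X 1 $ 1)\<^sup>2 = 0" "?k * (X 2 $ 1)\<^sup>2 = 0" "- (?k * (X 1 $ 1 + X 2 $ 1)\<^sup>2) = 1"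
    unfolding D by simp_all
  then show False by (auto simp: power2_eq_square)
qed

section \<open>Restriction and concise tensors\<close>

text \<open>This is full row rank of the first flattening, phrased as the absence of linear
  relations so that explicit tensors need only a finite coordinate check.\<close>

definition concise1 :: "('a::field, 'm1::finite, 'm2::finite, 'm3::finite) tensor \<Rightarrow> bool" where
  "concise1 S \<longleftrightarrow> (\<forall>c. (\<forall>b k. (\<Sum>a\<in>UNIV. c a * S $ a $ b $ k) = 0) \<longrightarrow> (\<forall>a. c a = 0))"

definition concise :: "('a::field, 'm1::finite, 'm2::finite, 'm3::finite) tensor \<Rightarrow> bool" where
  "concise S \<longleftrightarrow> concise1 S \<and> concise1 (swap12 S) \<and> concise1 (swap12 (swap23 S))"

lemma independent_if_concise1:
  assumes "concise1 S" and "\<And>a b c. tri T (X a) (Y b) (Z c) = S $ a $ b $ c"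
    and "\<And>y z. (\<Sum>a\<in>UNIV. c a * tri T (X a) y z) = 0"
  shows "\<forall>a. c a = 0"
  using assms(1,3) unfolding concise1_def assms(2)[symmetric] by blast

lemma rank_flattening1_ge_if_restricts_to:
  fixes S :: "('a::field, 'm1::finite, 'm2::finite, 'm3::finite) tensor"
  assumes "concise1 S" "T \<ge>\<^sub>t S"
  shows "CARD('m1) \<le> rank (flattening1 T)"
proof -
  obtain X Y Z where "\<And>a b c. tri T (X a) (Y b) (Z c) = S $ a $ b $ c"
    using assms(2) unfolding restricts_to_iff by blast
  from independent_if_concise1[OF assms(1) this] show ?thesis
    by (rule card_le_rank_flattening1)
qed

lemma rank_flattening1_le_if_restricted:
  fixes S :: "('a::field, 'm1::finite, 'm2::finite, 'm3::finite) tensor"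
  assumes "S \<ge>\<^sub>t T"
  shows "rank (flattening1 T) \<le> CARD('m1)"
proof -
  obtain A B C where T: "T = apply_tensor A B C S" using assms unfolding restricts_to_def by blast
  show ?thesis
  proof (rule rank_flattening1_le[of "\<lambda>a x. (x v* A) $ a"])
    fix x y z assume "\<forall>a. (x v* A) $ a = 0"
    then have "x v* A = 0" by (simp add: vec_eq_iff)
    then show "tri T x y z = 0" unfolding T tri_apply_tensor by simp
  qed (simp_all add: vector_matrix_mult_def sum.distrib sum_distrib_left algebra_simps)
qed

lemma rank_flattening_ge_if_restricts_to:
  fixes S :: "('a::field, 'm1::finite, 'm2::finite, 'm3::finite) tensor"
  assumes "concise S" "T \<ge>\<^sub>t S"
  shows "CARD('m1) \<le> rank (flattening1 T)" "CARD('m2) \<le> rank (flattening2 T)"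
    "CARD('m3) \<le> rank (flattening3 T)"
  using rank_flattening1_ge_if_restricts_to[of S T]
    rank_flattening1_ge_if_restricts_to[of "swap12 S" "swap12 T"]
    rank_flattening1_ge_if_restricts_to[of "swap12 (swap23 S)" "swap12 (swap23 T)"] assms
  by (simp_all add: concise_def restricts_to_swap rank_flattening_swap12 rank_flattening_swap23)

lemma rank_flattening_le_if_restricted:
  fixes S :: "('a::field, 'm1::finite, 'm2::finite, 'm3::finite) tensor"
  assumes "S \<ge>\<^sub>t T"
  shows "rank (flattening1 T) \<le> CARD('m1)" "rank (flattening2 T) \<le> CARD('m2)"
    "rank (flattening3 T) \<le> CARD('m3)"
  using rank_flattening1_le_if_restricted[of S T]
    rank_flattening1_le_if_restricted[of "swap12 S" "swap12 T"]
    rank_flattening1_le_if_restricted[of "swap12 (swap23 S)" "swap12 (swap23 T)"] assms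
  by (simp_all add: restricts_to_swap rank_flattening_swap12 rank_flattening_swap23)

text \<open>
  Since the flattenings of \<open>T\<close> have no larger rank than those of \<open>S\<close>, the vectors exhibiting \<open>T \<ge> S\<close> span each
  factor modulo the kernel of \<open>T\<close>.
\<close>

lemma restricts_to_reverse:
  fixes S :: "('a::field, 'm1::finite, 'm2::finite, 'm3::finite) tensor"
  assumes S: "concise S" and TS: "T \<ge>\<^sub>t S"
    and r: "rank (flattening1 T) \<le> CARD('m1)" "rank (flattening2 T) \<le> CARD('m2)"
      "rank (flattening3 T) \<le> CARD('m3)"
  shows "S \<ge>\<^sub>t T"
proof -
  obtain X Y Z where *: "\<And>a b c. tri T (X a) (Y b) (Z c) = S $ a $ b $ c"
    using TS unfolding restricts_to_iff by blast
  have c: "concise1 S" "concise1 (swap12 S)" "concise1 (swap12 (swap23 S))"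
    using S by (simp_all add: concise_def)
  have "\<exists>u. \<forall>y z. tri T x y z = (\<Sum>a\<in>UNIV. u a * tri T (X a) y z)" for x
    by (rule spanning_flattening1[OF independent_if_concise1[OF c(1), of T X Y Z]]) (simp_all add: * r)
  then obtain A where A: "\<And>x y z. tri T x y z = (\<Sum>a\<in>UNIV. A x a * tri T (X a) y z)" by metis
  have "\<exists>u. \<forall>x z. tri (swap12 T) y x z = (\<Sum>b\<in>UNIV. u b * tri (swap12 T) (Y b) x z)" for y
    by (rule spanning_flattening1[OF independent_if_concise1[OF c(2), of "swap12 T" Y X Z]])
      (simp_all add: * r rank_flattening_swap12)
  then obtain B where B: "\<And>x y z. tri T x y z = (\<Sum>b\<in>UNIV. B y b * tri T x (Y b) z)"
    unfolding tri_swap by metis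
  have "\<exists>u. \<forall>x y. tri (swap12 (swap23 T)) z x y = (\<Sum>k\<in>UNIV. u k * tri (swap12 (swap23 T)) (Z k) x y)" for z
    by (rule spanning_flattening1[OF independent_if_concise1[OF c(3), of "swap12 (swap23 T)" Z X Y]])
      (simp_all add: * r rank_flattening_swap12 rank_flattening_swap23)
  then obtain C where C: "\<And>x y z. tri T x y z = (\<Sum>k\<in>UNIV. C z k * tri T x y (Z k))"
    unfolding tri_swap by metis
  have T: "tri T x y z = tri S (\<chi> a. A x a) (\<chi> b. B y b) (\<chi> k. C z k)" for x y z
  proof -
    have "tri T x y z = (\<Sum>a\<in>UNIV. A x a * (\<Sum>b\<in>UNIV. B y b * (\<Sum>k\<in>UNIV. C z k * tri T (X a) (Y b) (Z k))))"
      unfolding A[of x y z] unfolding B[of "X _" y z] unfolding C[of "X _" "Y _" z] ..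
    then show ?thesis by (simp add: * tri_def[of S] sum_distrib_left mult.assoc)
  qed
  show ?thesis
    by (rule restricts_toI[of S "\<lambda>i. (\<chi> a. A (axis i 1) a)" "\<lambda>j. (\<chi> b. B (axis j 1) b)"
      "\<lambda>k. (\<chi> c. C (axis k 1) c)"]) (simp only: T[symmetric] tri_axis)
qed

lemma concise_I: "concise I_tensor"
  and concise_W: "concise W_tensor"
  by (auto simp: concise_def concise1_def forall_2 sum_2 I_tensor_def W_tensor_def basis_tensor_nth)

lemma concise_D: "concise D_tensor"
  by (auto simp: concise_def concise1_def forall_3 sum_3 D_tensor_def basis_tensor_nth)

lemma restricts_to_if_restricts_to_minus:
  assumes "T \<ge>\<^sub>t (\<chi> a b c. - S $ a $ b $ c)"
  shows "T \<ge>\<^sub>t S"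
proof -
  obtain X Y Z where "\<And>a b c. tri T (X a) (Y b) (Z c) = - S $ a $ b $ c"
    using assms unfolding restricts_to_iff by auto
  then show ?thesis
    by (intro restricts_toI[of T "\<lambda>a. - X a" Y Z]) (simp add: tri_linear)
qed

text \<open>A transposition of factors negates the skew-symmetric \<open>D_tensor\<close>, and the
  sign is absorbed into the first argument.\<close>

lemma restricts_to_D_swap:
  "swap12 T \<ge>\<^sub>t D_tensor \<Longrightarrow> T \<ge>\<^sub>t D_tensor"
  "swap23 T \<ge>\<^sub>t D_tensor \<Longrightarrow> T \<ge>\<^sub>t D_tensor"
proof -
  have *: "swap12 D_tensor = (\<chi> a b c. - D_tensor $ a $ b $ c)"
    "swap23 D_tensor = (\<chi> a b c. - D_tensor $ a $ b $ c)"
    by (simp_all add: vec_eq_iff forall_3 D_tensor_def basis_tensor_nth)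
  show "T \<ge>\<^sub>t D_tensor" if "swap12 T \<ge>\<^sub>t D_tensor"
    using restricts_to_swapI(1)[OF that] unfolding swap_swap * by (rule restricts_to_if_restricts_to_minus)
  show "T \<ge>\<^sub>t D_tensor" if "swap23 T \<ge>\<^sub>t D_tensor"
    using restricts_to_swapI(2)[OF that] unfolding swap_swap * by (rule restricts_to_if_restricts_to_minus)
qed

section \<open>Tensors whose slices have rank at most two in two directions\<close>

lemma poly_eq_0_if_all_roots:
  fixes p :: "'a::alg_closed_field poly"
  assumes "\<And>x. poly p x = 0"
  shows "p = 0"
proof (cases "degree p > 0")
  case True
  \<comment> \<open>A root of \<open>p + 1\<close> is a point where \<open>p\<close> takes the value
    -1.\<close>
  then have "degree (p + 1) > 0" by (simp add: degree_add_eq_left)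
  then show ?thesis using alg_closed_imp_poly_has_root[of "p + 1"] assms by auto
next
  case False
  then obtain c where "p = [:c:]" by (metis degree_eq_zeroE gr0I)
  then show ?thesis using assms[of 0] by simp
qed

text \<open>An identity in all \<open>k\<close> is an identity of polynomials, where a nonzero
  linear factor cancels. It extracts several relations at once from one valid for every direction
  \<open>(1, k)\<close>.\<close>

lemma linear_times_quadratic_eq_0:
  fixes l1 l2 :: "'a::alg_closed_field"
  assumes l: "l1 \<noteq> 0 \<or> l2 \<noteq> 0" and eq: "\<And>k. (l1 + k * l2) * (q0 + k * q1 + k * k * q2) = 0"
  shows "q0 = 0" "q1 = 0" "q2 = 0"
proof -
  have "[:l1, l2:] * [:q0, q1, q2:] = 0"
    by (rule poly_eq_0_if_all_roots) (use eq in \<open>simp add: algebra_simps\<close>)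
  then have "[:q0, q1, q2:] = 0" using l by auto
  then show "q0 = 0" "q1 = 0" "q2 = 0" by auto
qed

lemma linear_times_linear_eq_0:
  fixes l1 l2 :: "'a::alg_closed_field"
  assumes "l1 \<noteq> 0 \<or> l2 \<noteq> 0" and "\<And>k. (l1 + k * l2) * (m1 + k * m2) = 0"
  shows "m1 = 0" "m2 = 0"
proof -
  have "(l1 + k * l2) * (m1 + k * m2 + k * k * 0) = 0" for k
    using assms(2)[of k] by simp
  from linear_times_quadratic_eq_0[OF assms(1) this] show "m1 = 0" "m2 = 0" by blast+
qed

text \<open>Every slice \<open>T(x, \<cdot>, \<cdot>)\<close> has rank at most two: all its \<open>3 \<times> 3\<close> minors, in any bases, vanish.\<close>

definition low_rank :: "('a::field, 'n1::finite, 'n2::finite, 'n3::finite) tensor \<Rightarrow> bool" where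
  "low_rank T \<longleftrightarrow> (\<forall>x Y Z. det (\<chi> (b::3) (c::3). tri T x (Y b) (Z c)) = 0)"

lemma low_rankD:
  assumes "low_rank T"
  shows "tri T x y1 z1 * tri T x y2 z2 * tri T x y3 z3 + tri T x y1 z2 * tri T x y2 z3 * tri T x y3 z1 +
    tri T x y1 z3 * tri T x y2 z1 * tri T x y3 z2 - tri T x y1 z1 * tri T x y2 z3 * tri T x y3 z2 -
    tri T x y1 z2 * tri T x y2 z1 * tri T x y3 z3 - tri T x y1 z3 * tri T x y2 z2 * tri T x y3 z1 = 0"
  using assms[unfolded low_rank_def, rule_format, of x "\<lambda>b. if b = 1 then y1 else if b = 2 then y2 else y3"
    "\<lambda>c. if c = 1 then z1 else if c = 2 then z2 else z3"]
  by (simp add: det_3)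

text \<open>A slice of rank two at \<open>x0\<close> splits off complements \<open>YP\<close> and
  \<open>ZP\<close>, on whose product \<open>T\<close> vanishes. The minors then express every entry
  of a slice by three functionals of \<open>x\<close>, in a pattern that a change of bases turns
  into \<open>D_tensor\<close>.\<close>

lemma D_if_low_rank:
  fixes T :: "('a::alg_closed_field, 'n1::finite, 'n2::finite, 'n3::finite) tensor"
  assumes low1: "low_rank T" and low2: "low_rank (swap12 T)"
    and r: "rank (flattening1 T) \<ge> 3" "rank (flattening2 T) \<ge> 3" "rank (flattening3 T) \<ge> 3"
  shows "T \<ge>\<^sub>t D_tensor" "rank (flattening1 T) \<le> 3" "rank (flattening2 T) \<le> 3" "rank (flattening3 T) \<le> 3"
proof -
  have "tri T x y z = 0" if "T = 0" for x y z using that by (simp add: tri_def)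
  then have "T \<noteq> 0"
    using r(1) rank_flattening1_le_1[of T 0 0] by force
  then obtain x0 y1 y2 z1 z2 where "dual_pairs (tri T x0) y1 y2 z1 z2"
    using rank_2_slice_exists[of T] r by auto
  then have e: "tri T x0 y1 z1 = 1" "tri T x0 y1 z2 = 0" "tri T x0 y2 z1 = 0" "tri T x0 y2 z2 = 1"
    by (auto simp: dual_pairs_def)
  define YP where "YP y \<longleftrightarrow> tri T x0 y z1 = 0 \<and> tri T x0 y z2 = 0" for y
  define ZP where "ZP z \<longleftrightarrow> tri T x0 y1 z = 0 \<and> tri T x0 y2 z = 0" for z
  \<comment> \<open>the coefficients of \<open>1\<close> and \<open>s\<close> in the minor of \<open>T(x0 + s x, \<cdot>, \<cdot>)\<close> on \<open>(y1, y2, y) \<times> (z1, z2, z)\<close>\<close>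
  have F1: "tri T x y z = 0" if "YP y" "ZP z" for x y z
  proof -
    have yz: "tri T x0 y z1 = 0" "tri T x0 y z2 = 0" "tri T x0 y1 z = 0" "tri T x0 y2 z = 0"
      using that by (auto simp: YP_def ZP_def)
    define a11 a12 a21 a22 b1 b2 c1 c2 d d0 where ab: "a11 = tri T x y1 z1" "a12 = tri T x y1 z2"
      "a21 = tri T x y2 z1" "a22 = tri T x y2 z2" "b1 = tri T x y1 z" "b2 = tri T x y2 z"
      "c1 = tri T x y z1" "c2 = tri T x y z2" "d = tri T x y z" "d0 = tri T x0 y z"
    have *: "(1 + s * a11) * (1 + s * a22) * (d0 + s * d) + (s * a12) * (s * b2) * (s * c1)
       + (s * b1) * (s * a21) * (s * c2) - (1 + s * a11) * (s * b2) * (s * c2)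
       - (s * a12) * (s * a21) * (d0 + s * d) - (s * b1) * (1 + s * a22) * (s * c1) = 0" for s
      using low_rankD[OF low1, of "x0 + s *s x" y1 z1 y2 z2 y z]
      by (simp only: tri_linear e yz ab[symmetric] add_0_left)
    have "[:d0, d + d0 * (a11 + a22), (a11 + a22) * d + (a11 * a22 - a12 * a21) * d0 - b2 * c2 - b1 * c1,
      a11 * a22 * d + a12 * b2 * c1 + b1 * a21 * c2 - a11 * b2 * c2 - a12 * a21 * d - b1 * a22 * c1:] = 0"
      by (rule poly_eq_0_if_all_roots) (use * in \<open>simp add: algebra_simps\<close>)
    then have "d0 = 0" "d + d0 * (a11 + a22) = 0" unfolding pCons_eq_0_iff by blast+
    then have "d = 0" by simp
    then show ?thesis by (simp only: ab)
  qed
  \<comment> \<open>In the minor with rows \<open>x0, x, x'\<close> and columns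
    \<open>zw, zp, z\<close>, the first row is \<open>(1, 0, 0)\<close>.\<close>
  have det: "tri T x y zp * tri T x' y z = tri T x y z * tri T x' y zp"
    if "tri T x0 y zw = 1" "tri T x0 y zp = 0" "tri T x0 y z = 0" for x x' y zw zp z
    using low_rankD[OF low2, of y x0 zw x zp x' z] by (simp add: that)
  have dual: "\<exists>w1 w2. v1 * w1 + v2 * w2 = (1::'a)" if "v1 \<noteq> 0 \<or> v2 \<noteq> 0" for v1 v2
  proof (cases "v1 = 0")
    case True
    then show ?thesis using that by (intro exI[of _ 0] exI[of _ "inverse v2"]) simp
  next
    case False
    then show ?thesis by (intro exI[of _ "inverse v1"] exI[of _ 0]) simp
  qed
  \<comment> \<open>As functionals of \<open>x\<close>, both \<open>T(x, y_v, z_v)\<close> and \<open>T(x, y, z_v)\<close> are proportional to \<open>T(x, y_v, z)\<close>,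
    where \<open>y_v = v1 y1 + v2 y2\<close> and \<open>z_v = v2 z1 - v1 z2\<close>; the choice of \<open>z_v\<close> gives \<open>T(x0, y_v, z_v) = 0\<close>.\<close>
  have F3: "tri T x (v1 *s y1 + v2 *s y2) (v2 *s z1 - v1 *s z2) * tri T x' (v1 *s y1 + v2 *s y2) z
      = tri T x (v1 *s y1 + v2 *s y2) z * tri T x' (v1 *s y1 + v2 *s y2) (v2 *s z1 - v1 *s z2)"
    and F2: "tri T x y (v2 *s z1 - v1 *s z2) * tri T x' (v1 *s y1 + v2 *s y2) z
      = tri T x (v1 *s y1 + v2 *s y2) z * tri T x' y (v2 *s z1 - v1 *s z2)"
    if y: "YP y" and z: "ZP z" for x x' v1 v2 y z
  proof -
    let ?y = "v1 *s y1 + v2 *s y2" and ?z = "v2 *s z1 - v1 *s z2"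
    consider "v1 = 0" "v2 = 0" | "v1 \<noteq> 0 \<or> v2 \<noteq> 0" by blast
    then have "tri T x ?y ?z * tri T x' ?y z = tri T x ?y z * tri T x' ?y ?z \<and>
        tri T x y ?z * tri T x' ?y z = tri T x ?y z * tri T x' y ?z"
    proof cases
      case 2
      then obtain w1 w2 where w: "v1 * w1 + v2 * w2 = 1" using dual by blast
      let ?w = "w1 *s z1 + w2 *s z2"
      have yz: "tri T x0 y z1 = 0" "tri T x0 y z2 = 0" "tri T x0 y1 z = 0" "tri T x0 y2 z = 0"
        using y z by (auto simp: YP_def ZP_def)
      have 1: "tri T x0 ?y ?w = 1" using w by (simp add: tri_linear e mult.commute)
      have 2: "tri T x0 ?y ?z = 0" "tri T x0 ?y z = 0" by (simp_all add: tri_linear e yz mult.commute)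
      \<comment> \<open>\<open>?y + y\<close> meets the same normalization as \<open>?y\<close>.
        Expanding its minor and subtracting that of \<open>?y\<close> isolates the relation for
        \<open>y\<close>; the terms on \<open>YP\<close> and \<open>ZP\<close> drop out by
        \<open>F1\<close>.\<close>
      have 3: "tri T x0 (?y + y) ?w = 1" "tri T x0 (?y + y) ?z = 0" "tri T x0 (?y + y) z = 0"
        unfolding tri_add(2)[of T x0 ?y y] 1 2 by (simp_all add: tri_linear yz F1[OF y z])
      have 4: "tri T x ?y ?z * tri T x' ?y z = tri T x ?y z * tri T x' ?y ?z"
        by (rule det[OF 1 2])
      have "tri T x (?y + y) ?z * tri T x' (?y + y) z = tri T x (?y + y) z * tri T x' (?y + y) ?z"
        by (rule det[OF 3])
      then have "(tri T x ?y ?z + tri T x y ?z) * tri T x' ?y z = tri T x ?y z * (tri T x' ?y ?z + tri T x' y ?z)"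
        by (simp only: tri_add(2)[of T _ ?y y] F1[OF y z] add_0_right)
      then show ?thesis using 4 by (simp only: distrib_left distrib_right add_left_cancel)
    qed simp
    then show "tri T x ?y ?z * tri T x' ?y z = tri T x ?y z * tri T x' ?y ?z"
      "tri T x y ?z * tri T x' ?y z = tri T x ?y z * tri T x' y ?z" by blast+
  qed
  have decY: "YP (y - tri T x0 y z1 *s y1 - tri T x0 y z2 *s y2)" for y
    by (simp add: YP_def tri_linear e)
  have decZ: "ZP (z - tri T x0 y1 z *s z1 - tri T x0 y2 z *s z2)" for z
    by (simp add: ZP_def tri_linear e)
  have kerZ: "tri T x y z = 0" if "ZP z" "tri T x y1 z = 0" "tri T x y2 z = 0" for x y z
    using F1[OF decY[of y] that(1), of x] that(2,3) by (simp add: tri_linear)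
  have kerY: "tri T x y z = 0" if "YP y" "tri T x y z1 = 0" "tri T x y z2 = 0" for x y z
    using F1[OF that(1) decZ[of z], of x] that(2,3) by (simp add: tri_linear)
  obtain y3 xa za where "tri T x0 y3 z1 = 0" "tri T x0 y3 z2 = 0" and ya: "tri T xa y3 za \<noteq> 0"
    using rank_flattening1_ge_3E[of "swap12 T" x0 z1 x0 z2] r(2)
    by (auto simp: rank_flattening_swap12)
  then have y3: "YP y3" by (simp add: YP_def)
  with ya have xa: "tri T xa y3 z1 \<noteq> 0 \<or> tri T xa y3 z2 \<noteq> 0" using kerY by blast
  obtain z3 xb yb where "tri T x0 y1 z3 = 0" "tri T x0 y2 z3 = 0" and zb: "tri T xb yb z3 \<noteq> 0"
    using rank_flattening1_ge_3E[of "swap12 (swap23 T)" x0 y1 x0 y2] r(3)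
    by (auto simp: rank_flattening_swap12 rank_flattening_swap23)
  then have z3: "ZP z3" by (simp add: ZP_def)
  with zb have xb: "tri T xb y1 z3 \<noteq> 0 \<or> tri T xb y2 z3 \<noteq> 0" using kerZ by blast
  \<comment> \<open>The three functionals \<open>T(\<cdot>, y1, z3)\<close>, \<open>T(\<cdot>, y2, z3)\<close>, \<open>T(\<cdot>, y1, z1)\<close> determine \<open>T\<close>; below, \<open>x1, x2, x0\<close> is
    dual to them.\<close>
  have kerX: "tri T x y z = 0"
    if x: "tri T x y1 z3 = 0" "tri T x y2 z3 = 0" "tri T x y1 z1 = 0" for x y z
  proof -
    have c: "tri T x y z1 = 0" "tri T x y z2 = 0" if y: "YP y" for y
    proof -
      \<comment> \<open>This is \<open>F2\<close> for \<open>v = (1, k)\<close>; its right-hand side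
        vanishes by the choice of \<open>x\<close>, and \<open>xb\<close> keeps the linear factor
        nonzero.\<close>
      have "(tri T xb y1 z3 + k * tri T xb y2 z3) * (- tri T x y z2 + k * tri T x y z1) = 0" for k
        using F2[OF y z3, of x k 1 xb] by (simp add: tri_linear x algebra_simps)
      from linear_times_linear_eq_0[OF xb this] show "tri T x y z1 = 0" "tri T x y z2 = 0"
        by (simp_all only: neg_equal_0_iff_equal)
    qed
    have "(tri T xb y1 z3 + k * tri T xb y2 z3) *
        (- tri T x y1 z2 + k * (tri T x y1 z1 - tri T x y2 z2) + k * k * tri T x y2 z1) = 0" for k
      using F3[OF y3 z3, of x 1 k xb] by (simp add: tri_linear x algebra_simps)
    from linear_times_quadratic_eq_0[OF xb this]
    have a: "tri T x y1 z2 = 0" "tri T x y2 z2 = 0" "tri T x y2 z1 = 0" using x(3) by simp_all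
    have b: "tri T x y1 z = 0" "tri T x y2 z = 0" if z: "ZP z" for z
    proof -
      have ne: "- tri T xa y3 z2 \<noteq> 0 \<or> tri T xa y3 z1 \<noteq> 0" using xa by auto
      have "(- tri T xa y3 z2 + k * tri T xa y3 z1) * (tri T x y1 z + k * tri T x y2 z) = 0" for k
        using F2[OF y3 z, of x k 1 xa] c[OF y3] by (simp add: tri_linear algebra_simps)
      from linear_times_linear_eq_0[OF ne this] show "tri T x y1 z = 0" "tri T x y2 z = 0" by blast+
    qed
    have "tri T x y z1 = 0" "tri T x y z2 = 0" for y
      using c[OF decY[of y]] a x(3) by (simp_all add: tri_linear)
    moreover have "tri T x y (z - tri T x0 y1 z *s z1 - tri T x0 y2 z *s z2) = 0"
      by (rule kerZ[OF decZ b[OF decZ]])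
    ultimately show ?thesis by (simp add: tri_linear)
  qed
  show "rank (flattening1 T) \<le> 3"
    by (rule rank_flattening1_le_3[of T y1 z3 y2 z3 y1 z1]) (rule kerX)
  have x0: "tri T x0 y1 z3 = 0" "tri T x0 y2 z3 = 0" using z3 by (auto simp: ZP_def)
  obtain x1 where x1: "tri T x1 y1 z3 = 1" "tri T x1 y2 z3 = 0" "tri T x1 y1 z1 = 0"
  proof -
    obtain x y z where x: "tri T x y2 z3 = 0" "tri T x y1 z1 = 0" "tri T x y z \<noteq> 0"
      using rank_flattening1_ge_3E[OF r(1), of y2 z3 y1 z1] by blast
    then have "tri T x y1 z3 \<noteq> 0" using kerX by blast
    then show ?thesis using x by (intro that[of "inverse (tri T x y1 z3) *s x"]) (simp_all add: tri_linear)
  qed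
  obtain x2 where x2: "tri T x2 y1 z3 = 0" "tri T x2 y2 z3 = 1" "tri T x2 y1 z1 = 0"
  proof -
    obtain x y z where x: "tri T x y1 z3 = 0" "tri T x y1 z1 = 0" "tri T x y z \<noteq> 0"
      using rank_flattening1_ge_3E[OF r(1), of y1 z3 y1 z1] by blast
    then have "tri T x y2 z3 \<noteq> 0" using kerX by blast
    then show ?thesis using x by (intro that[of "inverse (tri T x y2 z3) *s x"]) (simp_all add: tri_linear)
  qed
  have g: "tri T x y z1 = tri T x2 y z1 * tri T x y2 z3" "tri T x y z2 = - (tri T x2 y z1 * tri T x y1 z3)"
    if y: "YP y" for x y
  proof -
    \<comment> \<open>The directions \<open>v = (0, 1)\<close> and \<open>v = (1, 0)\<close> each
      give a proportionality with its own constant; \<open>v = (1, 1)\<close> shows that the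
      constants agree up to sign.\<close>
    have 1: "tri T x y z1 = tri T x2 y z1 * tri T x y2 z3" for x
      using F2[OF y z3, of x 1 0 x2] by (simp add: x2 mult.commute)
    show "tri T x y z1 = tri T x2 y z1 * tri T x y2 z3" by (rule 1)
    have 2: "tri T x y z2 = tri T x1 y z2 * tri T x y1 z3" for x
      using F2[OF y z3, of x 0 1 x1] by (simp add: x1 tri_linear mult.commute)
    have "- tri T x1 y z2 = tri T x2 y z1"
      using F2[OF y z3, of x1 1 1 x2] 1[of x1] 2[of x2] by (simp add: x1 x2 tri_linear)
    then show "tri T x y z2 = - (tri T x2 y z1 * tri T x y1 z3)"
      using 2[of x] by (metis minus_mult_left minus_minus)
  qed
  show "rank (flattening2 T) \<le> 3"
  proof -
    have "tri (swap12 T) y x z = 0"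
      if "tri (swap12 T) y x0 z1 = 0" "tri (swap12 T) y x0 z2 = 0" "tri (swap12 T) y x2 z1 = 0" for y x z
    proof -
      have "YP y" "tri T x2 y z1 = 0" using that by (simp_all add: YP_def)
      then show ?thesis using g[of y x] kerY[of y x z] by simp
    qed
    then show ?thesis
      using rank_flattening1_le_3[of "swap12 T"] by (metis rank_flattening_swap12(1))
  qed
  define k where "k = tri T x2 y3 z1"
  have c: "tri T x y3 z1 = k * tri T x y2 z3" "tri T x y3 z2 = - (k * tri T x y1 z3)" for x
    unfolding k_def by (rule g[OF y3])+
  then have k: "k \<noteq> 0" using xa by auto
  have m: "tri T x y2 z = tri T x2 y2 z * tri T x y2 z3" "tri T x y1 z = tri T x2 y2 z * tri T x y1 z3"
    if z: "ZP z" for x z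
  proof -
    have 1: "tri T x y2 z = tri T x2 y2 z * tri T x y2 z3" for x
      using F2[OF y3 z, of x 1 0 x2] k by (simp add: c x2 mult.commute)
    show "tri T x y2 z = tri T x2 y2 z * tri T x y2 z3" by (rule 1)
    have 2: "tri T x y1 z = tri T x1 y1 z * tri T x y1 z3" for x
      using F2[OF y3 z, of x 0 1 x1] k by (simp add: c x1 tri_linear mult.commute)
    have "tri T x1 y1 z = tri T x2 y2 z"
      using F2[OF y3 z, of x1 1 1 x2] 1[of x1] 2[of x2] k by (simp add: c x1 x2 tri_linear)
    then show "tri T x y1 z = tri T x2 y2 z * tri T x y1 z3"
      using 2[of x] by simp
  qed
  show "rank (flattening3 T) \<le> 3"
  proof -
    let ?S = "swap12 (swap23 T)"
    have "tri ?S z x y = 0"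
      if "tri ?S z x0 y1 = 0" "tri ?S z x0 y2 = 0" "tri ?S z x2 y2 = 0" for z x y
    proof -
      have "ZP z" "tri T x2 y2 z = 0" using that by (simp_all add: ZP_def)
      then show ?thesis using m[of z x] kerZ[of z x y] by simp
    qed
    then show ?thesis
      using rank_flattening1_le_3[of ?S] by (metis rank_flattening_swap12(1) rank_flattening_swap23(2))
  qed
  define p q where pq: "p = tri T x1 y1 z2" "q = tri T x2 y2 z1"
  have a12: "tri T x y1 z2 = p * tri T x y1 z3" for x
    using F3[OF y3 z3, of x 1 0 x1] by (simp add: x1 tri_linear pq mult.commute)
  have a21: "tri T x y2 z1 = q * tri T x y2 z3" for x
    using F3[OF y3 z3, of x 0 1 x2] by (simp add: x2 tri_linear pq mult.commute)
  \<comment> \<open>The relation \<open>F3\<close> for all \<open>v = (1, s)\<close> forces the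
    difference of the diagonal entries to be a combination of \<open>T(x, y1, z3)\<close> and
    \<open>T(x, y2, z3)\<close>, so modulo these two the block is scalar.\<close>
  define d where "d x = tri T x y1 z1 - tri T x y2 z2" for x
  have av: "tri T x (1 *s y1 + s *s y2) (s *s z1 - 1 *s z2) =
      s * d x - p * tri T x y1 z3 + s * s * q * tri T x y2 z3" for x s
    by (simp add: tri_linear a12 a21 d_def algebra_simps)
  have "(0 + s * 1) * (- (p + d x2) + s * (d x1 - q)) = 0" for s
    using F3[OF y3 z3, of x1 1 s x2] unfolding av by (simp add: tri_linear x1 x2 algebra_simps)
  from linear_times_linear_eq_0[OF _ this] have d12: "d x1 = q" "d x2 = - p"
    by (simp_all add: add_eq_0_iff)
  have dx: "d x = q * tri T x y1 z3 - p * tri T x y2 z3" for x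
    using F3[OF y3 z3, of x 1 1 x1] unfolding av by (simp add: tri_linear x1 x2 d12 algebra_simps)
  have a22: "tri T x y2 z2 = tri T x y1 z1 - q * tri T x y1 z3 + p * tri T x y2 z3" for x
    using dx[of x] unfolding d_def by algebra
  have y3z3: "tri T x y3 z3 = 0" for x by (rule F1[OF y3 z3])
  have inv: "inverse k * (k * u) = u" for u using k by simp
  \<comment> \<open>Let u, v, w be the values of \<open>T\<close> at \<open>(x, y1, z3)\<close>,
    \<open>(x, y2, z3)\<close>, \<open>(x, y1, z1)\<close>. The corrections by \<open>q\<close> and
    \<open>p\<close> clear the combinations of u and v from the block, leaving the slice with rows
    \<open>(0, -w, u)\<close>, \<open>(w, 0, v)\<close>, \<open>(-u, -v, 0)\<close> in the bases
    \<open>?Y\<close>, \<open>?Z\<close>; the signs in \<open>?X\<close> match it to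
    \<open>D_tensor\<close>.\<close>
  let ?X = "\<lambda>a::3. if a = 1 then x2 else if a = 2 then - x1 else - x0"
  let ?Y = "\<lambda>b::3. if b = 1 then y1 else if b = 2 then y2 - (q * inverse k) *s y3 else inverse k *s y3"
  let ?Z = "\<lambda>c::3. if c = 1 then z2 - p *s z3 else if c = 2 then - z1 else z3"
  show "T \<ge>\<^sub>t D_tensor"
  proof (rule restricts_toI[of T ?X ?Y ?Z])
    have *: "\<forall>a b c. tri T (?X a) (?Y b) (?Z c) = D_tensor $ a $ b $ c"
      unfolding forall_3
      by (simp add: tri_linear a12 a21 a22 c y3z3 x0 x1 x2 e k inv D_tensor_def basis_tensor_nth mult.assoc)
    show "tri T (?X a) (?Y b) (?Z c) = D_tensor $ a $ b $ c" for a b c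
      by (rule *[rule_format])
  qed
qed

section \<open>Degeneration\<close>

definition polynomial_fun :: "('a::comm_ring_1 \<Rightarrow> 'a) \<Rightarrow> bool" where
  "polynomial_fun f \<longleftrightarrow> (\<exists>p. \<forall>t. f t = poly p t)"

lemma polynomial_fun_const: "polynomial_fun (\<lambda>t. c)"
  unfolding polynomial_fun_def by (rule exI[of _ "[:c:]"]) simp

lemma polynomial_fun_id: "polynomial_fun (\<lambda>t. t)"
  unfolding polynomial_fun_def by (rule exI[of _ "[:0, 1:]"]) simp

lemma polynomial_fun_add: "polynomial_fun f \<Longrightarrow> polynomial_fun g \<Longrightarrow> polynomial_fun (\<lambda>t. f t + g t)"
  unfolding polynomial_fun_def by (metis poly_add)

lemma polynomial_fun_diff: "polynomial_fun f \<Longrightarrow> polynomial_fun g \<Longrightarrow> polynomial_fun (\<lambda>t. f t - g t)"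
  unfolding polynomial_fun_def by (metis poly_diff)

lemma polynomial_fun_mult: "polynomial_fun f \<Longrightarrow> polynomial_fun g \<Longrightarrow> polynomial_fun (\<lambda>t. f t * g t)"
  unfolding polynomial_fun_def by (metis poly_mult)

lemmas polynomial_fun_intros =
  polynomial_fun_const polynomial_fun_id polynomial_fun_add polynomial_fun_diff polynomial_fun_mult

lemma polynomial_fun_common_nonzero:
  fixes f g :: "'a::alg_closed_field \<Rightarrow> 'a"
  assumes f: "polynomial_fun f" "f s \<noteq> 0" and g: "polynomial_fun g" "g r \<noteq> 0"
  shows "\<exists>t. f t \<noteq> 0 \<and> g t \<noteq> 0"
proof -
  obtain p q where p: "\<And>t. f t = poly p t" and q: "\<And>t. g t = poly q t"
    using f(1) g(1) unfolding polynomial_fun_def by blast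
  have "p * q \<noteq> 0" using f(2) g(2) by (auto simp: p q)
  then obtain t where "poly (p * q) t \<noteq> 0" using poly_eq_0_if_all_roots by blast
  then show ?thesis by (auto simp: p q)
qed

lemma polynomial_fun_det3:
  assumes "\<And>a b. polynomial_fun (\<lambda>t. M t $ a $ b)"
  shows "polynomial_fun (\<lambda>t. det (M t :: 'a::comm_ring_1^3^3))"
  unfolding det_3 by (intro polynomial_fun_intros assms)

text \<open>One elimination step, with the pivot at a nonzero coordinate.\<close>

lemma matrix_to_axis_exists:
  fixes w :: "'a::field^3"
  assumes "w \<noteq> 0"
  shows "\<exists>G. det G \<noteq> 0 \<and> G *v w = axis 1 1"
proof -
  consider "w $ 1 \<noteq> 0" | "w $ 2 \<noteq> 0" | "w $ 3 \<noteq> 0"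
    using assms by (auto simp: vec_eq_iff forall_3)
  then show ?thesis
  proof cases
    case 1
    then show ?thesis
      by (intro exI[of _ "vector [vector [inverse (w $ 1), 0, 0], vector [- w $ 2 / w $ 1, 1, 0],
          vector [- w $ 3 / w $ 1, 0, 1]]"])
        (simp add: det_3 vec_eq_iff forall_3 matrix_vector_mult_def sum_3 axis_def)
  next
    case 2
    then show ?thesis
      by (intro exI[of _ "vector [vector [0, inverse (w $ 2), 0], vector [1, - w $ 1 / w $ 2, 0],
          vector [0, - w $ 3 / w $ 2, 1]]"])
        (simp add: det_3 vec_eq_iff forall_3 matrix_vector_mult_def sum_3 axis_def)
  next
    case 3
    then show ?thesis
      by (intro exI[of _ "vector [vector [0, 0, inverse (w $ 3)], vector [0, 1, - w $ 2 / w $ 3],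
          vector [1, 0, - w $ 1 / w $ 3]]"])
        (simp add: det_3 vec_eq_iff forall_3 matrix_vector_mult_def sum_3 axis_def)
  qed
qed

text \<open>
  Each choice is made on the line joining a point satisfying one condition to a point satisfying the other.
\<close>

lemma generic_frame_exists:
  fixes T :: "('a::alg_closed_field, 'n1::finite, 'n2::finite, 'n3::finite) tensor"
  assumes Z: "det (\<chi> (a::3) (c::3). tri T (X a) y (Z c)) \<noteq> 0"
    and Y: "det (\<chi> (a::3) (b::3). tri T (X' a) (Y b) z') \<noteq> 0"
  shows "\<exists>X z. det (\<chi> (a::3) (c::3). tri T (X a) y (Z c)) \<noteq> 0 \<and>
    det (\<chi> (a::3) (b::3). tri T (X a) (Y b) z) \<noteq> 0 \<and> (\<exists>a::3. tri T (X a) y z \<noteq> 0)"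
proof -
  \<comment> \<open>A nonzero entry of the first matrix provides a point at which the third
    condition holds; \<open>z\<close> moves first, then the frame \<open>X\<close>.\<close>
  obtain a c where ac: "tri T (X a) y (Z c) \<noteq> 0"
    using Z unfolding det_3 by fastforce
  let ?z = "\<lambda>t. z' + t *s (Z c - z')"
  have "\<exists>t. det (\<chi> (a::3) (b::3). tri T (X' a) (Y b) (?z t)) \<noteq> 0 \<and> tri T (X a) y (?z t) \<noteq> 0"
  proof (rule polynomial_fun_common_nonzero[of _ 0 _ 1])
    show "polynomial_fun (\<lambda>t. det (\<chi> (a::3) (b::3). tri T (X' a) (Y b) (?z t)))"
      by (intro polynomial_fun_det3) (simp add: tri_linear polynomial_fun_intros)
    show "polynomial_fun (\<lambda>t. tri T (X a) y (?z t))"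
      by (simp add: tri_linear polynomial_fun_intros)
  qed (use Y ac in simp_all)
  then obtain z where z: "det (\<chi> (a::3) (b::3). tri T (X' a) (Y b) z) \<noteq> 0" "tri T (X a) y z \<noteq> 0"
    by blast
  let ?X = "\<lambda>t a. X a + t *s (X' a - X a)"
  have p: "polynomial_fun (\<lambda>t. tri T (?X t a) y z)" for a y z
    by (simp add: tri_linear polynomial_fun_intros)
  have "\<exists>t. det (\<chi> (a::3) (b::3). tri T (?X t a) (Y b) z) \<noteq> 0 \<and>
      det (\<chi> (a::3) (c::3). tri T (?X t a) y (Z c)) * tri T (?X t a) y z \<noteq> 0"
  proof (rule polynomial_fun_common_nonzero[of _ 1 _ 0])
    show "polynomial_fun (\<lambda>t. det (\<chi> (a::3) (b::3). tri T (?X t a) (Y b) z))"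
      by (rule polynomial_fun_det3) (simp only: vec_lambda_beta p)
    show "polynomial_fun (\<lambda>t. det (\<chi> (a::3) (c::3). tri T (?X t a) y (Z c)) * tri T (?X t a) y z)"
      by (intro polynomial_fun_mult polynomial_fun_det3 p) (simp only: vec_lambda_beta p)
  qed (use z Z in simp_all)
  then obtain t where "det (\<chi> (a::3) (b::3). tri T (?X t a) (Y b) z) \<noteq> 0"
    "det (\<chi> (a::3) (c::3). tri T (?X t a) y (Z c)) \<noteq> 0" "tri T (?X t a) y z \<noteq> 0"
    by auto
  then show ?thesis by (intro exI[of _ "?X t"] exI[of _ z]) auto
qed

lemma adapted_frame_exists:
  fixes T :: "('a::alg_closed_field, 'n1::finite, 'n2::finite, 'n3::finite) tensor"
  assumes low2: "\<not> low_rank (swap12 T)" and low3: "\<not> low_rank (swap12 (swap23 T))"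
  shows "\<exists>X Y Z. (\<forall>(a::3) (c::3). tri T (X a) (Y (1::3)) (Z c) = of_bool (a = c)) \<and>
    (\<forall>a b. tri T (X a) (Y b) (Z 1) = of_bool (a = b))"
proof -
  obtain X y Z X' Y z' where "det (\<chi> (a::3) (c::3). tri T (X a) y (Z c)) \<noteq> 0"
    "det (\<chi> (a::3) (b::3). tri T (X' a) (Y b) z') \<noteq> 0"
    using low2 low3 unfolding low_rank_def tri_swap by blast
  from generic_frame_exists[OF this] obtain X z a0 where
    A: "det (\<chi> (a::3) (c::3). tri T (X a) y (Z c)) \<noteq> 0" (is "det ?A \<noteq> 0") and
    B: "det (\<chi> (a::3) (b::3). tri T (X a) (Y b) z) \<noteq> 0" (is "det ?B \<noteq> 0") and
    a0: "tri T (X a0) y z \<noteq> 0"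
    by blast
  have "(\<chi> a. tri T (X a) y z) \<noteq> 0" using a0 by (auto simp: vec_eq_iff)
  then obtain G where G: "det G \<noteq> 0" and Gw: "G *v (\<chi> a. tri T (X a) y z) = axis 1 1"
    using matrix_to_axis_exists by blast
  define X1 where "X1 a = (\<Sum>a'\<in>UNIV. G $ a $ a' *s X a')" for a
  have "det (G ** ?A) \<noteq> 0" "det (G ** ?B) \<noteq> 0" using G A B by (simp_all add: det_mul)
  then obtain Q R where Q: "G ** ?A ** Q = mat 1" and R: "G ** ?B ** R = mat 1"
    by (metis invertible_det_nz invertible_def)
  \<comment> \<open>After \<open>G\<close>, the vector of values at \<open>(y, z)\<close> is the
    first column of the identity. So \<open>z\<close> and \<open>y\<close> themselves can be the
    first vectors of the two frames, and \<open>Q\<close> and \<open>R\<close> supply the remaining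
    ones.\<close>
  define Z1 where "Z1 c = (if c = 1 then z else \<Sum>c'\<in>UNIV. Q $ c' $ c *s Z c')" for c
  define Y1 where "Y1 b = (if b = 1 then y else \<Sum>b'\<in>UNIV. R $ b' $ b *s Y b')" for b
  have yz: "tri T (X1 a) y z = of_bool (a = 1)" for a
  proof -
    have "tri T (X1 a) y z = (G *v (\<chi> a. tri T (X a) y z)) $ a"
      by (simp add: X1_def tri_linear matrix_vector_mult_def)
    then show ?thesis by (simp add: Gw axis_def)
  qed
  have "tri T (X1 a) y (\<Sum>c'\<in>UNIV. Q $ c' $ c *s Z c') = (G ** ?A ** Q) $ a $ c" for a c
    by (simp add: X1_def tri_linear matrix_matrix_mult_def mult.commute)
  then have 1: "tri T (X1 a) (Y1 1) (Z1 c) = of_bool (a = c)" for a c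
    unfolding Q by (simp add: Y1_def Z1_def yz mat_def)
  have "tri T (X1 a) (\<Sum>b'\<in>UNIV. R $ b' $ b *s Y b') z = (G ** ?B ** R) $ a $ b" for a b
    by (simp add: X1_def tri_linear matrix_matrix_mult_def mult.commute)
  then have 2: "tri T (X1 a) (Y1 b) (Z1 1) = of_bool (a = b)" for a b
    unfolding R by (simp add: Y1_def Z1_def yz mat_def)
  show ?thesis using 1 2 by blast
qed

section \<open>Laurent polynomial maps and the degeneration to \<open>N1_tensor\<close>\<close>

lemma laurent_polynomial_monomial:
  "laurent_polynomial (fls_const c)" "laurent_polynomial (fls_X * fls_const c)"
  "laurent_polynomial (fls_X_inv * fls_const (c :: 'a::comm_ring_1))"
proof -
  have "laurent_polynomial (fls_shift m (fls_const c))" for m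
  proof -
    have "{n. fls_nth (fls_shift m (fls_const c)) n \<noteq> 0} \<subseteq> {- m}" by (auto split: if_splits)
    then show ?thesis unfolding laurent_polynomial_def by (rule finite_subset) simp
  qed
  from this[of 0] this[of "-1"] this[of 1]
  show "laurent_polynomial (fls_const c)" "laurent_polynomial (fls_X * fls_const c)"
    "laurent_polynomial (fls_X_inv * fls_const c)"
    by (simp_all add: fls_X_times_conv_shift fls_X_inv_times_conv_shift)
qed

lemma fls_const_sum: "fls_const (\<Sum>i\<in>S. f i) = (\<Sum>i\<in>S. fls_const (f i))"
  for f :: "_ \<Rightarrow> 'a::comm_ring_1"
  by (induction S rule: infinite_finite_induct) (simp_all add: fls_plus_const[symmetric])

lemma degenerates_toI:
  assumes "laurent_polynomial_matrix A" "laurent_polynomial_matrix B" "laurent_polynomial_matrix C"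
    and "apply_tensor A B C (const_tensor T) =
      const_tensor S + (\<Sum>r=1..t. scale_tensor (fls_X ^ r) (const_tensor (R r)))"
  shows "T \<unrhd>\<^sub>t S"
  unfolding degenerates_to_def using assms by blast

lemma N1_tensor_nth:
  "N1_tensor $ a $ b $ c = (if b = 1 then of_bool (a = c) else if c = 1 then of_bool (a = b) else 0)"
  using exhaust_3[of a] exhaust_3[of b] exhaust_3[of c]
  by (elim disjE; simp add: N1_tensor_def basis_tensor_nth)

lemma degenerates_to_N1_if_adapted_frame:
  fixes T :: "('a::field, 'n1::finite, 'n2::finite, 'n3::finite) tensor"
  assumes 1: "\<And>a c. tri T (X a) (Y (1::3)) (Z c) = of_bool (a = (c::3))"
    and 2: "\<And>a b. tri T (X a) (Y b) (Z 1) = of_bool (a = b)"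
  shows "T \<unrhd>\<^sub>t N1_tensor"
proof -
  define v :: "3 \<Rightarrow> 'a fls" where "v a = (if a = 1 then 1 else fls_X_inv)" for a
  define w :: "3 \<Rightarrow> 'a fls" where "w a = (if a = 1 then 1 else fls_X)" for a
  define A :: "'a fls^'n1^3" where "A = (\<chi> a i. v a * fls_const (X a $ i))"
  define B :: "'a fls^'n2^3" where "B = (\<chi> b j. w b * fls_const (Y b $ j))"
  define C :: "'a fls^'n3^3" where "C = (\<chi> c k. w c * fls_const (Z c $ k))"
  \<comment> \<open>On the two identity slices the weights of the nonzero entries cancel. Elsewhere
    \<open>b\<close> and \<open>c\<close> contribute \<open>fls_X\<close> each and \<open>a\<close>
    contributes 1 or \<open>fls_X_inv\<close>, so an entry has order 2 if \<open>a = 1\<close> and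
    order 1 otherwise.\<close>
  define R :: "nat \<Rightarrow> ('a, 3, 3, 3) tensor" where
    "R r = (\<chi> a b c. if b \<noteq> 1 \<and> c \<noteq> 1 \<and> (a = 1 \<longleftrightarrow> r = 2) then tri T (X a) (Y b) (Z c) else 0)" for r
  let ?S = "const_tensor N1_tensor + (\<Sum>r=1..2. scale_tensor (fls_X ^ r) (const_tensor (R r)))"
  have vw: "fls_X_inv * (fls_X * u) = u" for u :: "'a fls"
    by (simp add: fls_X_times_conv_shift fls_X_inv_times_conv_shift)
  have "apply_tensor A B C (const_tensor T) $ a $ b $ c = ?S $ a $ b $ c" for a b c
  proof -
    let ?t = "tri T (X a) (Y b) (Z c)"
    have "A $ a $ i * B $ b $ j * C $ c $ k * const_tensor T $ i $ j $ k =
        v a * w b * w c * fls_const (X a $ i * Y b $ j * Z c $ k * T $ i $ j $ k)" for i j k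
      by (simp add: A_def B_def C_def const_tensor_def fls_const_mult_const[symmetric] mult_ac
          del: fls_const_mult_const)
    then have lhs: "apply_tensor A B C (const_tensor T) $ a $ b $ c = v a * w b * w c * fls_const ?t"
      by (simp add: apply_tensor_def tri_def fls_const_sum sum_distrib_left)
    have s: "{1..2::nat} = {1, 2}" by auto
    have rhs: "?S $ a $ b $ c = fls_const (N1_tensor $ a $ b $ c) + fls_X * fls_const (R 1 $ a $ b $ c)
        + fls_X * (fls_X * fls_const (R 2 $ a $ b $ c))"
      unfolding s by (simp add: const_tensor_def scale_tensor_def power2_eq_square mult.assoc)
    consider "b = 1" | "c = 1" "b \<noteq> 1" | "a = 1" "b \<noteq> 1" "c \<noteq> 1" | "a \<noteq> 1" "b \<noteq> 1" "c \<noteq> 1" by blast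
    then show ?thesis
    proof cases
      case 1
      then show ?thesis unfolding lhs rhs N1_tensor_nth
        using vw[of 1] by (simp add: assms v_def w_def R_def)
    next
      case 2
      then show ?thesis unfolding lhs rhs N1_tensor_nth
        using vw[of 1] by (simp add: assms v_def w_def R_def)
    next
      case 3
      then show ?thesis unfolding lhs rhs N1_tensor_nth
        by (simp add: v_def w_def R_def mult.assoc)
    next
      case 4
      then show ?thesis unfolding lhs rhs N1_tensor_nth
        by (simp add: v_def w_def R_def mult.assoc vw)
    qed
  qed
  then have "apply_tensor A B C (const_tensor T) = ?S" by (simp only: vec_eq_iff) blast
  moreover have "laurent_polynomial_matrix A" "laurent_polynomial_matrix B" "laurent_polynomial_matrix C"
    by (simp_all add: laurent_polynomial_matrix_def A_def B_def C_def v_def w_def laurent_polynomial_monomial)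
  ultimately show ?thesis by (intro degenerates_toI[where A = A and B = B and C = C and R = R])
qed

lemma degenerates_to_swap:
  assumes "T \<unrhd>\<^sub>t S"
  shows "swap12 T \<unrhd>\<^sub>t swap12 S" "swap23 T \<unrhd>\<^sub>t swap23 S"
proof -
  obtain A B C t R where L: "laurent_polynomial_matrix A" "laurent_polynomial_matrix B" "laurent_polynomial_matrix C"
    and eq: "apply_tensor A B C (const_tensor T) =
      const_tensor S + (\<Sum>r=1..(t::nat). scale_tensor (fls_X ^ r) (const_tensor (R r)))"
    using assms unfolding degenerates_to_def by blast
  have *: "apply_tensor B A C (const_tensor (swap12 T)) $ b $ a $ c = apply_tensor A B C (const_tensor T) $ a $ b $ c" for a b c
    by (simp add: apply_tensor_def const_tensor_def, subst sum.swap) (simp add: mult_ac)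
  have "apply_tensor B A C (const_tensor (swap12 T)) =
      const_tensor (swap12 S) + (\<Sum>r=1..t. scale_tensor (fls_X ^ r) (const_tensor (swap12 (R r))))"
    unfolding vec_eq_iff by (intro allI) (simp only: * eq, simp add: const_tensor_def scale_tensor_def)
  then show "swap12 T \<unrhd>\<^sub>t swap12 S"
    by (rule degenerates_toI[OF L(2,1,3), where R = "\<lambda>r. swap12 (R r)"])
  have *: "apply_tensor A C B (const_tensor (swap23 T)) $ a $ c $ b = apply_tensor A B C (const_tensor T) $ a $ b $ c" for a b c
    by (simp add: apply_tensor_def const_tensor_def, intro sum.cong refl, subst sum.swap) (simp add: mult_ac)
  have "apply_tensor A C B (const_tensor (swap23 T)) =
      const_tensor (swap23 S) + (\<Sum>r=1..t. scale_tensor (fls_X ^ r) (const_tensor (swap23 (R r))))"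
    unfolding vec_eq_iff by (intro allI) (simp only: * eq, simp add: const_tensor_def scale_tensor_def)
  then show "swap23 T \<unrhd>\<^sub>t swap23 S"
    by (rule degenerates_toI[OF L(1,3,2), where R = "\<lambda>r. swap23 (R r)"])
qed

section \<open>The classification\<close>

text \<open>With the invariance of \<open>low_rank\<close> under \<open>swap23\<close>, this
  identifies the condition in the third direction before and after \<open>swap12\<close>.\<close>

lemma swap_braid: "swap12 (swap23 (swap12 T)) = swap23 (swap12 (swap23 T))"
  by (simp add: vec_eq_iff)

lemma low_rank_swap23I:
  assumes "low_rank T"
  shows "low_rank (swap23 T)"
  unfolding low_rank_def
proof (intro allI)
  fix x Z Y
  have "(\<chi> (c::3) (b::3). tri (swap23 T) x (Z c) (Y b)) = transpose (\<chi> b c. tri T x (Y b) (Z c))"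
    by (simp add: transpose_def)
  then show "det (\<chi> (c::3) (b::3). tri (swap23 T) x (Z c) (Y b)) = 0"
    using assms by (simp only: det_transpose low_rank_def)
qed

lemma low_rank_swap23 [simp]: "low_rank (swap23 T) \<longleftrightarrow> low_rank T"
  using low_rank_swap23I[of T] low_rank_swap23I[of "swap23 T"] by auto

lemma restricts_to_trans:
  assumes "T \<ge>\<^sub>t S" "S \<ge>\<^sub>t R"
  shows "T \<ge>\<^sub>t R"
proof -
  obtain A B C where S: "S = apply_tensor A B C T"
    using assms(1) unfolding restricts_to_def by blast
  obtain X Y Z where "\<And>a b c. tri S (X a) (Y b) (Z c) = R $ a $ b $ c"
    using assms(2) unfolding restricts_to_iff by blast
  then show ?thesis unfolding S tri_apply_tensor by (rule restricts_toI)
qed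

text \<open>The number of the target is the direction whose basis is shared by the two identity
  slices; slices must reach rank three in the other two directions. Swapping factors permutes the
  three targets.\<close>

lemma degenerates_to_N:
  fixes T :: "('a::alg_closed_field, 'n1::finite, 'n2::finite, 'n3::finite) tensor"
  shows "\<not> low_rank (swap12 T) \<Longrightarrow> \<not> low_rank (swap12 (swap23 T)) \<Longrightarrow> T \<unrhd>\<^sub>t N1_tensor"
    and "\<not> low_rank T \<Longrightarrow> \<not> low_rank (swap12 (swap23 T)) \<Longrightarrow> T \<unrhd>\<^sub>t N2_tensor"
    and "\<not> low_rank T \<Longrightarrow> \<not> low_rank (swap12 T) \<Longrightarrow> T \<unrhd>\<^sub>t N3_tensor"
proof -
  have N1: "T \<unrhd>\<^sub>t N1_tensor" if "\<not> low_rank (swap12 T)" "\<not> low_rank (swap12 (swap23 T))"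
    for T :: "('a, 'm1::finite, 'm2::finite, 'm3::finite) tensor"
    using adapted_frame_exists[OF that] degenerates_to_N1_if_adapted_frame by blast
  have N2: "T \<unrhd>\<^sub>t N2_tensor" if "\<not> low_rank T" "\<not> low_rank (swap12 (swap23 T))"
    for T :: "('a, 'm1::finite, 'm2::finite, 'm3::finite) tensor"
  proof -
    have "swap12 T \<unrhd>\<^sub>t N1_tensor" by (rule N1) (use that in \<open>simp_all add: swap_braid\<close>)
    moreover have "swap12 N1_tensor = (N2_tensor :: ('a, 3, 3, 3) tensor)"
      by (simp add: vec_eq_iff forall_3 N1_tensor_def N2_tensor_def basis_tensor_nth)
    ultimately show ?thesis using degenerates_to_swap(1)[of "swap12 T" N1_tensor] by simp
  qed
  show "\<not> low_rank (swap12 T) \<Longrightarrow> \<not> low_rank (swap12 (swap23 T)) \<Longrightarrow> T \<unrhd>\<^sub>t N1_tensor" by (rule N1)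
  show "\<not> low_rank T \<Longrightarrow> \<not> low_rank (swap12 (swap23 T)) \<Longrightarrow> T \<unrhd>\<^sub>t N2_tensor" by (rule N2)
  assume "\<not> low_rank T" "\<not> low_rank (swap12 T)"
  then have "swap23 T \<unrhd>\<^sub>t N2_tensor" by (intro N2) simp_all
  moreover have "swap23 N2_tensor = (N3_tensor :: ('a, 3, 3, 3) tensor)"
    by (simp add: vec_eq_iff forall_3 N2_tensor_def N3_tensor_def basis_tensor_nth)
  ultimately show "T \<unrhd>\<^sub>t N3_tensor" using degenerates_to_swap(2)[of "swap23 T" N2_tensor] by simp
qed

text \<open>Swaps move the two directions of low rank to the first two. The rank bounds obtained
  there make the restriction to \<open>D_tensor\<close> reversible.\<close>

lemma equivalent_to_D_if_low_rank:
  fixes T :: "('a::alg_closed_field, 'n1::finite, 'n2::finite, 'n3::finite) tensor"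
  assumes r: "rank (flattening1 T) \<ge> 3" "rank (flattening2 T) \<ge> 3" "rank (flattening3 T) \<ge> 3"
    and low: "low_rank T \<and> low_rank (swap12 T) \<or> low_rank T \<and> low_rank (swap12 (swap23 T)) \<or>
      low_rank (swap12 T) \<and> low_rank (swap12 (swap23 T))"
  shows "T \<ge>\<^sub>t D_tensor \<and> D_tensor \<ge>\<^sub>t T"
proof -
  have 1: "T \<ge>\<^sub>t D_tensor \<and> D_tensor \<ge>\<^sub>t T"
    if "low_rank T" "low_rank (swap12 T)" and
      "rank (flattening1 T) \<ge> 3" "rank (flattening2 T) \<ge> 3" "rank (flattening3 T) \<ge> 3"
    for T :: "('a, 'm1::finite, 'm2::finite, 'm3::finite) tensor"
    using D_if_low_rank[OF that] by (simp add: restricts_to_reverse[OF concise_D])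
  have D: "T \<ge>\<^sub>t D_tensor \<and> rank (flattening1 T) \<le> 3 \<and> rank (flattening2 T) \<le> 3 \<and> rank (flattening3 T) \<le> 3"
    if "low_rank T" "low_rank (swap12 (swap23 T))" and
      "rank (flattening1 T) \<ge> 3" "rank (flattening2 T) \<ge> 3" "rank (flattening3 T) \<ge> 3"
    for T :: "('a, 'm1::finite, 'm2::finite, 'm3::finite) tensor"
    using D_if_low_rank[of "swap23 T"] that restricts_to_D_swap(2)[of T]
    by (simp add: rank_flattening_swap23)
  have D': "T \<ge>\<^sub>t D_tensor \<and> rank (flattening1 T) \<le> 3 \<and> rank (flattening2 T) \<le> 3 \<and> rank (flattening3 T) \<le> 3"
    if "low_rank (swap12 T)" "low_rank (swap12 (swap23 T))"
    using D[of "swap12 T"] that r restricts_to_D_swap(1)[of T]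
    by (simp add: rank_flattening_swap12 swap_braid)
  show ?thesis
    using low 1[of T] D[of T] D' r restricts_to_reverse[OF concise_D, of T] by auto
qed

theorem theorem2p3:
  fixes T :: "('a::alg_closed_field, 'n1::finite, 'n2::finite, 'n3::finite) tensor"
  assumes "T \<noteq> 0"
  shows "count_list
      [rank (flattening1 T) = 1 \<or> rank (flattening2 T) = 1 \<or> rank (flattening3 T) = 1,
       W_tensor \<ge>\<^sub>t T \<and> T \<ge>\<^sub>t W_tensor,
       T \<ge>\<^sub>t I_tensor \<and>
         (rank (flattening1 T) = 2 \<or> rank (flattening2 T) = 2 \<or> rank (flattening3 T) = 2),
       rank (flattening1 T) \<ge> 3 \<and> rank (flattening2 T) \<ge> 3 \<and> rank (flattening3 T) \<ge> 3]
      True = 1 \<and>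
    (rank (flattening1 T) \<ge> 3 \<and> rank (flattening2 T) \<ge> 3 \<and> rank (flattening3 T) \<ge> 3 \<longrightarrow>
      (T \<unrhd>\<^sub>t N1_tensor \<or> T \<unrhd>\<^sub>t N2_tensor \<or> T \<unrhd>\<^sub>t N3_tensor) \<or>
      (T \<ge>\<^sub>t D_tensor \<and> D_tensor \<ge>\<^sub>t T))"
proof -
  let ?r1 = "rank (flattening1 T)" and ?r2 = "rank (flattening2 T)" and ?r3 = "rank (flattening3 T)"
  define P Q R S where "P \<longleftrightarrow> ?r1 = 1 \<or> ?r2 = 1 \<or> ?r3 = 1"
    and "Q \<longleftrightarrow> W_tensor \<ge>\<^sub>t T \<and> T \<ge>\<^sub>t W_tensor"
    and "R \<longleftrightarrow> T \<ge>\<^sub>t I_tensor \<and> (?r1 = 2 \<or> ?r2 = 2 \<or> ?r3 = 2)"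
    and "S \<longleftrightarrow> ?r1 \<ge> 3 \<and> ?r2 \<ge> 3 \<and> ?r3 \<ge> 3"
  note defs = this
  have "swap12 T \<noteq> 0" "swap12 (swap23 T) \<noteq> 0"
    using assms by (auto simp: vec_eq_iff)
  then have pos: "?r1 \<ge> 1" "?r2 \<ge> 1" "?r3 \<ge> 1"
    using rank_flattening1_pos[of T] rank_flattening1_pos[of "swap12 T"]
      rank_flattening1_pos[of "swap12 (swap23 T)"] assms
    by (simp_all add: rank_flattening_swap12 rank_flattening_swap23)
  have Q: "?r1 = 2" "?r2 = 2" "?r3 = 2" if Q
    using that rank_flattening_ge_if_restricts_to[OF concise_W, of T]
      rank_flattening_le_if_restricted[of W_tensor T]
    by (simp_all add: defs)
  have I: "?r1 \<ge> 2" "?r2 \<ge> 2" "?r3 \<ge> 2" if "T \<ge>\<^sub>t I_tensor"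
    using that rank_flattening_ge_if_restricts_to[OF concise_I, of T] by simp_all
  have excl: "\<not> (P \<and> Q)" "\<not> (P \<and> R)" "\<not> (P \<and> S)" "\<not> (Q \<and> S)" "\<not> (R \<and> S)"
    using Q I by (auto simp: defs)
  \<comment> \<open>Otherwise \<open>W_tensor\<close> would restrict to \<open>I_tensor\<close>
    through \<open>T\<close>.\<close>
  have QR: "\<not> (Q \<and> R)" using restricts_to_trans[of W_tensor T I_tensor] not_W_restricts_to_I by (auto simp: defs)
  have ex: "P \<or> Q \<or> R \<or> S"
  proof (rule ccontr)
    assume no: "\<not> ?thesis"
    then have ge: "?r1 \<ge> 2" "?r2 \<ge> 2" "?r3 \<ge> 2" using pos by (auto simp: defs)
    moreover have two: "?r1 = 2 \<or> ?r2 = 2 \<or> ?r3 = 2" using no ge by (auto simp: defs)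
    ultimately have "T \<ge>\<^sub>t I_tensor \<or> (T \<ge>\<^sub>t W_tensor \<and> ?r1 = 2 \<and> ?r2 = 2 \<and> ?r3 = 2)" by (rule I_or_W)
    \<comment> \<open>In the second alternative all ranks are two, so \<open>T\<close> restricting
      to the concise \<open>W_tensor\<close> can be reversed.\<close>
    then show False
      using no two restricts_to_reverse[OF concise_W, of T] by (auto simp: defs)
  qed
  have "count_list [P, Q, R, S] True = 1"
    using excl QR ex by auto
  moreover have "S \<longrightarrow> (T \<unrhd>\<^sub>t N1_tensor \<or> T \<unrhd>\<^sub>t N2_tensor \<or> T \<unrhd>\<^sub>t N3_tensor) \<or>
      (T \<ge>\<^sub>t D_tensor \<and> D_tensor \<ge>\<^sub>t T)"
    using degenerates_to_N[of T] equivalent_to_D_if_low_rank[of T] unfolding defs by blast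
  ultimately show ?thesis unfolding defs by blast
qed

end
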